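(* Let $\Omega\subset\mathbb{P}(\mathbb{R}^{d+1})$ be a properly convex domain and let $\gamma\in\mathrm{Aut}(\Omega)$ be a rank one isometry with axis $\ell_\gamma$. Then $\ell_\gamma$ is $\mathcal{K}$-Morse for some Morse gauge $\mathcal{K}:[1,\infty)\times[0,\infty)\to[0,\infty)$; that is, if $\alpha$ is a $(\lambda,\varepsilon)$-quasi-geodesic in $(\Omega,d_\Omega)$ with endpoints on $\ell_\gamma$, then $\alpha\subset\mathcal{N}_{\mathcal{K}(\lambda,\varepsilon)}(\ell_\gamma)$.
   Context: A properly convex domain is a nonempty open set $\Omega\subset\mathbb{P}(\mathbb{R}^{d+1})$ such that some affine chart contains $\overline\Omega$ and in it $\Omega$ is a bounded convex set. For $x,y\in\overline\Omega$, $[x,y]\subset\overline\Omega$ is the closed projective line segment joining them, and $(x,y)=[x,y]\setminus\{x,y\}$. The Hilbert metric is $d_\Omega(x,y)=\frac12\log\frac{|b-x||y-a|}{|b-y||x-a|}$, where $a,b\in\partial\Omega$ are the endpoints of the intersection of $\overline\Omega$ with the projective line through $x\ne y$, ordered $a,x,y,b$ (computed in an affine chart containing $\overline{\Omega}$). $\mathrm{Aut}(\Omega)=\{g\in\mathrm{PGL}_{d+1}(\mathbb{R}): g\Omega=\Omega\}$. Rank one isometry: $\gamma\in\mathrm{Aut}(\Omega)$ is a rank one isometry if (a) $\tau_\Omega(\gamma):=\inf_{x\in\Omega}d_\Omega(x,\gamma x)>0$; (b) $\gamma$ has an axis, i.e. a non-trivial (open) projective line segment of the form $\mathbb{P}(V)\cap\Omega$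 with $V\le\mathbb{R}^{d+1}$ a two-dimensional $\gamma$-invariant linear subspace; (c) no axis $(a,b)$ of $\gamma$ ($a,b\in\partial\Omega$) is contained in a half triangle in $\Omega$, i.e. there is no $z\in\partial\Omega$ with $[a,z]\cup[z,b]\subset\partial\Omega$. (A rank one isometry has a unique axis.) A $(\lambda,\varepsilon)$-quasi-geodesic is the image of a $(\lambda,\varepsilon)$-quasi-isometric embedding of a real interval, i.e. a map $F$ with $\frac1\lambda|s-t|-\varepsilon\le d_\Omega(F(s),F(t))\le\lambda|s-t|+\varepsilon$. $\mathcal{N}_r(\ell)=\{x\in\Omega: d_\Omega(x,\ell)<r\}$. *)

theory Defs
  imports "HOL-Analysis.Analysis"
begin

text \<open>
  Points of the real projective space of lines in \<open>real ^ 'n\<close>.  With \<open>CARD('n) = d + 1\<close> this is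
  $\mathbb{P}(\mathbb{R}^{d+1})$.
\<close>

typedef (overloaded) ('n::finite) proj = "{L :: (real ^ 'n) set. subspace L \<and> dim L = 1}"
  morphisms line_of Abs_proj
proof
  have "(axis undefined 1 :: real ^ 'n) \<noteq> 0"
    by (simp add: axis_eq_0_iff)
  then show "span {axis undefined 1 :: real ^ 'n} \<in> {L. subspace L \<and> dim L = 1}"
    by (simp add: dim_singleton)
qed

text \<open>The quotient topology: the preimage of \<open>U\<close> in \<open>real ^ 'n - {0}\<close> is open.\<close>

instantiation proj :: (finite) topological_space
begin

definition open_proj :: "'a proj set \<Rightarrow> bool" where
  "open_proj U \<longleftrightarrow> open ((\<Union>p\<in>U. line_of p) - {0})"

instance
proof
  have line: "span {v} \<in> {L :: (real ^ 'a) set. subspace L \<and> dim L = 1}" if "v \<noteq> 0" for v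
    using that by (simp add: dim_singleton)
  have "(\<Union>p\<in>(UNIV :: 'a proj set). line_of p) - {0} = - {0}"
  proof (intro equalityI subsetI)
    fix v :: "real ^ 'a" assume "v \<in> - {0}"
    then have "v \<noteq> 0" by simp
    then have "v \<in> line_of (Abs_proj (span {v}))"
      using Abs_proj_inverse[OF line] by (simp add: span_base)
    with \<open>v \<noteq> 0\<close> show "v \<in> (\<Union>p\<in>UNIV. line_of p) - {0}" by blast
  qed auto
  then show "open (UNIV :: 'a proj set)"
    by (simp add: open_proj_def open_Compl)
next
  have uniq: "p = q" if "v \<in> line_of p" "v \<in> line_of q" "v \<noteq> 0" for p q :: "'a proj" and v
  proof -
    have "line_of r = span {v}" if "v \<in> line_of r" for r :: "'a proj"
    proof -
      have r: "subspace (line_of r)" "dim (line_of r) = 1"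
        using line_of[of r] by auto
      have "span {v} \<subseteq> line_of r"
        using r that by (simp add: span_minimal)
      moreover have "dim (span {v}) = 1"
        using \<open>v \<noteq> 0\<close> by (simp add: dim_singleton)
      ultimately show ?thesis
        using r by (metis subspace_dim_equal subspace_span order_refl)
    qed
    with that show ?thesis by (metis line_of_inject)
  qed
  fix S T :: "'a proj set"
  assume "open S" "open T"
  moreover have "(\<Union>p\<in>S \<inter> T. line_of p) - {0} =
      ((\<Union>p\<in>S. line_of p) - {0}) \<inter> ((\<Union>p\<in>T. line_of p) - {0})"
    using uniq by auto
  ultimately show "open (S \<inter> T)"
    by (simp only: open_proj_def) (simp only: open_Int)
next
  fix K :: "'a proj set set"
  assume "\<forall>S\<in>K. open S"
  moreover have "(\<Union>p\<in>\<Union>K. line_of p) - {0} = (\<Union>S\<in>K. (\<Union>p\<in>S. line_of p) - {0})"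
    by auto
  ultimately show "open (\<Union>K)"
    by (simp only: open_proj_def) (simp only: open_UN)
qed

end

definition proj_of :: "(real ^ 'n) set \<Rightarrow> ('n::finite) proj set" where
  "proj_of V = {p. line_of p \<subseteq> V}"

definition proj_line :: "('n::finite) proj \<Rightarrow> 'n proj \<Rightarrow> 'n proj set" where
  "proj_line x y = proj_of (span (line_of x \<union> line_of y))"

text \<open>
  A vector \<open>w \<noteq> 0\<close> gives the affine chart of all lines not contained in the hyperplane
  \<open>{v. w \<bullet> v = 0}\<close>.  Its coordinates live in the affine hyperplane \<open>{v. w \<bullet> v = 1}\<close>, with the
  norm of \<open>real ^ 'n\<close>: a line is sent to its point of intersection with that hyperplane.
\<close>

definition chart_domain :: "real ^ 'n \<Rightarrow> ('n::finite) proj set" where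
  "chart_domain w = {p. \<not> line_of p \<subseteq> {v. w \<bullet> v = 0}}"

definition chart :: "real ^ 'n \<Rightarrow> ('n::finite) proj \<Rightarrow> real ^ 'n" where
  "chart w p = (THE v. v \<in> line_of p \<and> w \<bullet> v = 1)"

definition convex_in_chart :: "real ^ 'n \<Rightarrow> ('n::finite) proj set \<Rightarrow> bool" where
  "convex_in_chart w \<Omega> \<longleftrightarrow> w \<noteq> 0 \<and> closure \<Omega> \<subseteq> chart_domain w
     \<and> bounded (chart w ` \<Omega>) \<and> convex (chart w ` \<Omega>)"

definition properly_convex_domain :: "('n::finite) proj set \<Rightarrow> bool" where
  "properly_convex_domain \<Omega> \<longleftrightarrow> \<Omega> \<noteq> {} \<and> open \<Omega> \<and> (\<exists>w. convex_in_chart w \<Omega>)"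

text \<open>
  Segments and cross ratios are computed in one chart containing the closure of \<open>\<Omega>\<close>; for a
  properly convex domain they do not depend on which one.
\<close>

definition chart_of :: "('n::finite) proj set \<Rightarrow> 'n proj \<Rightarrow> real ^ 'n" where
  "chart_of \<Omega> = chart (SOME w. convex_in_chart w \<Omega>)"

definition segment :: "('n::finite) proj set \<Rightarrow> 'n proj \<Rightarrow> 'n proj \<Rightarrow> 'n proj set" where
  "segment \<Omega> x y =
     {p \<in> closure \<Omega>. chart_of \<Omega> p \<in> closed_segment (chart_of \<Omega> x) (chart_of \<Omega> y)}"

definition segment_open :: "('n::finite) proj set \<Rightarrow> 'n proj \<Rightarrow> 'n proj \<Rightarrow> 'n proj set" where
  "segment_open \<Omega> x y = segment \<Omega> x y - {x, y}"

text \<open>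
  \<open>a\<close> and \<open>b\<close> are the endpoints of the chord of \<open>\<Omega>\<close> through \<open>x \<noteq> y\<close>; the last two conjuncts
  say that the four points come in the order \<open>a\<close>, \<open>x\<close>, \<open>y\<close>, \<open>b\<close>.
\<close>

definition chord_ends ::
  "('n::finite) proj set \<Rightarrow> 'n proj \<Rightarrow> 'n proj \<Rightarrow> 'n proj \<Rightarrow> 'n proj \<Rightarrow> bool" where
  "chord_ends \<Omega> x y a b \<longleftrightarrow> a \<in> frontier \<Omega> \<and> b \<in> frontier \<Omega>
     \<and> closure \<Omega> \<inter> proj_line x y = segment \<Omega> a b
     \<and> x \<in> segment \<Omega> a y \<and> y \<in> segment \<Omega> x b"

definition hilbert_dist :: "('n::finite) proj set \<Rightarrow> 'n proj \<Rightarrow> 'n proj \<Rightarrow> real" where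
  "hilbert_dist \<Omega> x y =
     (if x = y then 0
      else (THE r. \<exists>a b. chord_ends \<Omega> x y a b \<and>
        r = 1 / 2 * ln
          (dist (chart_of \<Omega> b) (chart_of \<Omega> x) * dist (chart_of \<Omega> y) (chart_of \<Omega> a) /
           (dist (chart_of \<Omega> b) (chart_of \<Omega> y) * dist (chart_of \<Omega> x) (chart_of \<Omega> a)))))"

text \<open>
  An element of $\mathrm{PGL}_{d+1}(\mathbb{R})$ is identified with the transformation of
  projective space it induces; two invertible matrices induce the same transformation iff they
  differ by a nonzero scalar.
\<close>

definition induces :: "real ^ 'n ^ 'n \<Rightarrow> (('n::finite) proj \<Rightarrow> 'n proj) \<Rightarrow> bool" where
  "induces A g \<longleftrightarrow> invertible A \<and> (\<forall>p. line_of (g p) = (\<lambda>v. A *v v) ` line_of p)"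

definition PGL :: "(('n::finite) proj \<Rightarrow> 'n proj) set" where
  "PGL = {g. \<exists>A. induces A g}"

definition Aut :: "('n::finite) proj set \<Rightarrow> ('n proj \<Rightarrow> 'n proj) set" where
  "Aut \<Omega> = {g \<in> PGL. g ` \<Omega> = \<Omega>}"

definition invariant_subspace :: "(('n::finite) proj \<Rightarrow> 'n proj) \<Rightarrow> (real ^ 'n) set \<Rightarrow> bool" where
  "invariant_subspace g V \<longleftrightarrow> subspace V \<and> (\<exists>A. induces A g \<and> (\<lambda>v. A *v v) ` V \<subseteq> V)"

definition translation_length :: "('n::finite) proj set \<Rightarrow> ('n proj \<Rightarrow> 'n proj) \<Rightarrow> real" where
  "translation_length \<Omega> g = (INF x\<in>\<Omega>. hilbert_dist \<Omega> x (g x))"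

definition is_axis :: "('n::finite) proj set \<Rightarrow> ('n proj \<Rightarrow> 'n proj) \<Rightarrow> 'n proj set \<Rightarrow> bool" where
  "is_axis \<Omega> g l \<longleftrightarrow>
     (\<exists>V. invariant_subspace g V \<and> dim V = 2 \<and> l = proj_of V \<inter> \<Omega>)
     \<and> (\<exists>a\<in>closure \<Omega>. \<exists>b\<in>closure \<Omega>. a \<noteq> b \<and> l = segment_open \<Omega> a b)"

definition in_half_triangle :: "('n::finite) proj set \<Rightarrow> 'n proj \<Rightarrow> 'n proj \<Rightarrow> bool" where
  "in_half_triangle \<Omega> a b \<longleftrightarrow>
     (\<exists>z\<in>frontier \<Omega>. segment \<Omega> a z \<union> segment \<Omega> z b \<subseteq> frontier \<Omega>)"

definition rank_one_isometry :: "('n::finite) proj set \<Rightarrow> ('n proj \<Rightarrow> 'n proj) \<Rightarrow> bool" where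
  "rank_one_isometry \<Omega> g \<longleftrightarrow> g \<in> Aut \<Omega>
     \<and> translation_length \<Omega> g > 0
     \<and> (\<exists>l. is_axis \<Omega> g l)
     \<and> (\<forall>a\<in>frontier \<Omega>. \<forall>b\<in>frontier \<Omega>.
          is_axis \<Omega> g (segment_open \<Omega> a b) \<longrightarrow> \<not> in_half_triangle \<Omega> a b)"

definition quasi_isometric_embedding ::
  "('n::finite) proj set \<Rightarrow> real \<Rightarrow> real \<Rightarrow> real set \<Rightarrow> (real \<Rightarrow> 'n proj) \<Rightarrow> bool" where
  "quasi_isometric_embedding \<Omega> lam eps I F \<longleftrightarrow> F ` I \<subseteq> \<Omega> \<and>
     (\<forall>s\<in>I. \<forall>t\<in>I. 1 / lam * \<bar>s - t\<bar> - eps \<le> hilbert_dist \<Omega> (F s) (F t)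
        \<and> hilbert_dist \<Omega> (F s) (F t) \<le> lam * \<bar>s - t\<bar> + eps)"

text \<open>
  Quasi-geodesics with endpoints \<open>p\<close> and \<open>q\<close>, i.e. those parametrized by a compact interval.
  The map \<open>F\<close> is not assumed to be continuous.
\<close>

definition quasi_geodesic_between ::
  "('n::finite) proj set \<Rightarrow> real \<Rightarrow> real \<Rightarrow> 'n proj \<Rightarrow> 'n proj \<Rightarrow> 'n proj set \<Rightarrow> bool" where
  "quasi_geodesic_between \<Omega> lam eps p q \<alpha> \<longleftrightarrow>
     (\<exists>s t F. s \<le> t \<and> quasi_isometric_embedding \<Omega> lam eps {s..t} F
        \<and> F s = p \<and> F t = q \<and> \<alpha> = F ` {s..t})"

definition hilbert_nbhd :: "('n::finite) proj set \<Rightarrow> real \<Rightarrow> 'n proj set \<Rightarrow> 'n proj set" where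
  "hilbert_nbhd \<Omega> r l = {x \<in> \<Omega>. (INF y\<in>l. hilbert_dist \<Omega> x y) < r}"

definition morse_gauge :: "(real \<times> real \<Rightarrow> real) \<Rightarrow> bool" where
  "morse_gauge K \<longleftrightarrow> K \<in> {1..} \<times> {0..} \<rightarrow> {0..}"

definition morse :: "('n::finite) proj set \<Rightarrow> (real \<times> real \<Rightarrow> real) \<Rightarrow> 'n proj set \<Rightarrow> bool" where
  "morse \<Omega> K l \<longleftrightarrow>
     (\<forall>lam\<ge>1. \<forall>eps\<ge>0. \<forall>p\<in>l. \<forall>q\<in>l. \<forall>\<alpha>.
        quasi_geodesic_between \<Omega> lam eps p q \<alpha> \<longrightarrow> \<alpha> \<subseteq> hilbert_nbhd \<Omega> (K (lam, eps)) l)"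

end

theory Submission
  imports Defs
begin

text \<open>
  Lift \<open>\<Omega>\<close> to an open convex cone \<open>C\<close>.  By Birkhoff's formula, the Hilbert distance of two points
  is at most \<open>r\<close> iff representatives satisfy \<open>\<alpha> x \<le> y \<le> \<beta> x\<close> in the order of \<open>closure C\<close> with
  \<open>\<beta> \<le> exp (2 r) \<alpha>\<close>.  The isometry lifts to a linear automorphism of \<open>C\<close> with eigenvectors \<open>a\<close> and
  \<open>b\<close> at the ends of the axis and eigenvalues \<open>lam > mu\<close>.  Applying powers of it to a boundary
  segment at \<open>a\<close> and passing to the limit would produce a half triangle over the axis, so no
  boundary segment ends at \<open>a\<close>, nor at \<open>b\<close>.  Hence the invariant supporting functionals \<open>f\<close> at
  \<open>b\<close> and \<open>g\<close> at \<open>a\<close> vanish on \<open>closure C\<close> only along the rays of \<open>b\<close> and \<open>a\<close>.  The function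
  \<open>\<pi> = ln (f / g) / 2\<close> is 1-Lipschitz and restricts to an isometric parametrization of the axis; by
  compactness and equivariance, a segment along which \<open>\<pi>\<close> changes by a large amount passes
  within distance \<open>1\<close> of the axis.  Such a contraction property implies the Morse property.
\<close>

section \<open>Contracting projections and quasi-geodesics\<close>

text \<open>The hypothesis forbids only half triangles over the axis, but the compactness argument
  needs each supporting functional at an end of the axis to vanish on the ray of that end alone.
  Otherwise points with large \<pi> could accumulate at other boundary points, and segments between
  points with very different \<pi> might stay away from the axis. The gap \<open>lam > mu\<close>
  between the eigenvalues is what bridges the two conditions.

  The group generated by the isometry need not act cocompactly on \<Omega>. Compactness is therefore
  used for normalized vectors of \<open>closure C\<close>, boundary included, and equivariance of
  \<pi> serves only to move a long interval of values into a standard position.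

  The cone order replaces cross ratios because it is linear: the triangle inequality, invariance
  under the lift and the Lipschitz bound for \<pi> become manipulations of vector
  inequalities.\<close>

text \<open>An excursion far from \<open>L\<close> moves \<pi> slowly. The distance between its ends
  is controlled by the change of \<pi>, which is at most half the parameter length divided by
  \<open>lam\<close>, up to a constant, while the quasi-isometry inequality forces the full
  quotient. So excursions have bounded parameter length, and \<open>R\<close> depends only on the
  constants.\<close>

lemma quasi_geodesic_near_contracting:
  fixes d :: "'a \<Rightarrow> 'a \<Rightarrow> real" and \<pi> :: "'a \<Rightarrow> real"
  assumes sym: "\<And>x y. x \<in> X \<Longrightarrow> y \<in> X \<Longrightarrow> d x y = d y x"
    and tri: "\<And>x y z. x \<in> X \<Longrightarrow> y \<in> X \<Longrightarrow> z \<in> X \<Longrightarrow> d x z \<le> d x y + d y z"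
    and refl: "\<And>x. x \<in> X \<Longrightarrow> d x x = 0"
    and lip: "\<And>x y. x \<in> X \<Longrightarrow> y \<in> X \<Longrightarrow> \<bar>\<pi> x - \<pi> y\<bar> \<le> d x y"
    and LX: "L \<subseteq> X"
    and geod: "\<And>p q. p \<in> L \<Longrightarrow> q \<in> L \<Longrightarrow> d p q \<le> \<bar>\<pi> p - \<pi> q\<bar>"
    and contr: "\<And>x y. x \<in> X \<Longrightarrow> y \<in> X \<Longrightarrow> (\<forall>p\<in>L. d x y + N \<le> d x p) \<Longrightarrow> \<bar>\<pi> x - \<pi> y\<bar> \<le> B"
    and lam: "lam \<ge> 1" and eps: "eps \<ge> 0"
  shows "\<exists>R\<ge>0. \<forall>s t (F :: real \<Rightarrow> 'a). s \<le> t \<longrightarrow> F ` {s..t} \<subseteq> X \<longrightarrow> F s \<in> L \<longrightarrow> F t \<in> L \<longrightarrow>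
    (\<forall>u\<in>{s..t}. \<forall>v\<in>{s..t}. 1 / lam * \<bar>u - v\<bar> - eps \<le> d (F u) (F v) \<and> d (F u) (F v) \<le> lam * \<bar>u - v\<bar> + eps) \<longrightarrow>
    (\<forall>u\<in>{s..t}. \<exists>p\<in>L. d (F u) p \<le> R)"
proof -
  define B' where "B' = max B 1"
  \<comment> \<open>Far from \<open>L\<close>, a piece of parameter length \<open>h\<close> moves \<open>\<pi>\<close> by at most \<open>B'\<close>, a quarter of \<open>h / lam\<close>.\<close>
  define h where "h = 4 * lam * B'"
  \<comment> \<open>A parameter step of length \<open>h\<close> moves the point by at most
    \<open>lam * h + eps\<close>; outside the \<open>D\<close>-neighbourhood of \<open>L\<close> the
    hypothesis of \<open>contr\<close> thus holds for such steps.\<close>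
  define D where "D = lam * h + eps + \<bar>N\<bar>"
  \<comment> \<open>The extra \<open>lam + eps\<close> pays for a parameter shift of at most
    1.\<close>
  define D' where "D' = D + lam + eps"
  define T where "T = 2 * lam * (4 * D' + 4 * B' + eps)"
  define R where "R = lam * T + eps + D'"
  have B'1: "B' \<ge> 1" "B' \<ge> B" by (auto simp: B'_def)
  have h0: "h > 0" using lam B'1 by (auto simp: h_def intro!: mult_pos_pos)
  have D0: "D \<ge> 0" using lam eps h0 by (auto simp: D_def)
  have D'0: "D' \<ge> 0" "D \<le> D'" using D0 lam eps by (auto simp: D'_def)
  have T0: "T \<ge> 0" using D'0 lam eps B'1 by (auto simp: T_def)
  have R0: "R \<ge> 0" "D' \<le> R" using T0 D'0 lam eps by (auto simp: R_def)
  have "\<exists>p\<in>L. d (F u) p \<le> R"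
    if st: "s \<le> t" and FX: "F ` {s..t} \<subseteq> X" and Fs: "F s \<in> L" and Ft: "F t \<in> L"
      and lo: "\<And>u v. u \<in> {s..t} \<Longrightarrow> v \<in> {s..t} \<Longrightarrow> 1 / lam * \<bar>u - v\<bar> - eps \<le> d (F u) (F v)"
      and up: "\<And>u v. u \<in> {s..t} \<Longrightarrow> v \<in> {s..t} \<Longrightarrow> d (F u) (F v) \<le> lam * \<bar>u - v\<bar> + eps"
      and u: "u \<in> {s..t}" for s t F u
  proof (rule ccontr)
    assume far: "\<not> (\<exists>p\<in>L. d (F u) p \<le> R)"
    define G where "G = {v \<in> {s..t}. \<exists>p\<in>L. d (F v) p \<le> D}"
    have X: "F v \<in> X" if "v \<in> {s..t}" for v using FX that by auto
    have "d (F s) (F s) \<le> D" "d (F t) (F t) \<le> D" using Fs Ft refl LX D0 by auto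
    then have sG: "s \<in> G" "t \<in> G" using Fs Ft st by (auto simp: G_def)
    \<comment> \<open>Since \<open>F\<close> may jump, \<open>s0\<close> and \<open>t0\<close> need
      not belong to \<open>G\<close>. Members \<open>s1\<close> and \<open>t1\<close> of
      \<open>G\<close> at parameter distance less than 1 replace them.\<close>
    define s0 where "s0 = Sup (G \<inter> {..u})"
    define t0 where "t0 = Inf (G \<inter> {u..})"
    have ne: "s \<in> G \<inter> {..u}" "t \<in> G \<inter> {u..}" using sG u by auto
    have bd: "bdd_above (G \<inter> {..u})" "bdd_below (G \<inter> {u..})" by auto
    have "s0 - 1 < Sup (G \<inter> {..u})" "t0 + 1 > Inf (G \<inter> {u..})" by (auto simp: s0_def t0_def)
    then obtain s1 t1 where s1: "s1 \<in> G" "s1 \<le> u" "s0 - 1 < s1" and t1: "t1 \<in> G" "u \<le> t1" "t1 < t0 + 1"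
      using ne less_cSup_iff[OF _ bd(1)] cInf_less_iff[OF _ bd(2)] by (metis IntE atMost_iff atLeast_iff empty_iff)
    have s1s0: "s1 \<le> s0" unfolding s0_def using s1 bd by (intro cSup_upper) auto
    have t1t0: "t0 \<le> t1" unfolding t0_def using t1 bd by (intro cInf_lower) auto
    have s0u: "s0 \<le> u" unfolding s0_def using ne by (intro cSup_least) auto
    have ut0: "u \<le> t0" unfolding t0_def using ne by (intro cInf_greatest) auto
    have s1t: "s1 \<in> {s..t}" "t1 \<in> {s..t}" using s1 t1 by (auto simp: G_def)
    have notG: "v \<notin> G" if "s0 < v" "v < t0" for v
    proof
      assume v: "v \<in> G"
      show False
      proof (cases "v \<le> u")
        case True then have "v \<le> s0" unfolding s0_def using v bd by (intro cSup_upper) auto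
        then show False using that by simp
      next
        case False then have "t0 \<le> v" unfolding t0_def using v bd by (intro cInf_lower) auto
        then show False using that by simp
      qed
    qed
    obtain p q where p: "p \<in> L" "d (F s1) p \<le> D" and q: "q \<in> L" "d (F t1) q \<le> D"
      using s1 t1 by (auto simp: G_def)
    have pX: "p \<in> X" "q \<in> X" using p q LX by auto
    \<comment> \<open>Only \<open>v\<close> has to lie in the gap between \<open>s0\<close> and
      \<open>t0\<close>, so a step may also end at \<open>s1\<close> or \<open>t1\<close>.\<close>
    have far_step: "\<bar>\<pi> (F v) - \<pi> (F v')\<bar> \<le> B'"
      if "s0 < v" "v < t0" "v' \<in> {s..t}" "\<bar>v - v'\<bar> \<le> h" for v v'
    proof -
      have v: "v \<in> {s..t}" using that s1s0 t1t0 s1t by auto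
      then have gt: "d (F v) p > D" if "p \<in> L" for p using notG[OF \<open>s0 < v\<close> \<open>v < t0\<close>] that by (force simp: G_def)
      have "d (F v) (F v') \<le> lam * \<bar>v - v'\<bar> + eps" using up v that by auto
      also have "\<dots> \<le> lam * h + eps" using lam that by simp
      finally have "\<forall>p\<in>L. d (F v) (F v') + N \<le> d (F v) p" using gt by (force simp: D_def)
      from contr[OF X X this] v that B'1 show ?thesis by force
    qed
    show False
    proof (cases "s0 < u \<and> u < t0")
      case False
      have "\<exists>v\<in>G. \<bar>u - v\<bar> \<le> 1"
      proof (cases "s0 < u")
        case True then show ?thesis using False t1 ut0 by (intro bexI[of _ t1]) auto
      next
        case False then show ?thesis using s1 s0u by (intro bexI[of _ s1]) auto
      qed
      then obtain v r where v: "v \<in> {s..t}" "\<bar>u - v\<bar> \<le> 1" and r: "r \<in> L" "d (F v) r \<le> D" by (auto simp: G_def)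
      have "d (F u) r \<le> d (F u) (F v) + d (F v) r" using X u v r LX by (intro tri) auto
      also have "\<dots> \<le> lam * 1 + eps + D"
        using up[OF u v(1)] r(2) mult_left_mono[OF v(2), of lam] lam by linarith
      also have "\<dots> \<le> R" using R0 by (simp add: D'_def)
      finally show False using far r by auto
    next
      case True
      have step: "\<bar>\<pi> (F v) - \<pi> (F u)\<bar> \<le> B' * real n"
        if "s0 < v" "v < t0" "\<bar>v - u\<bar> \<le> h * real n" for v n
        using that
      proof (induction n arbitrary: v)
        case 0 then show ?case by simp
      next
        case (Suc n)
        have hn: "h * real (Suc n) = h * real n + h" by (simp add: algebra_simps)
        have "\<exists>v'. s0 < v' \<and> v' < t0 \<and> \<bar>v' - u\<bar> \<le> h * real n \<and> \<bar>v - v'\<bar> \<le> h"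
        proof -
          have hp: "h * real n \<ge> 0" using h0 by simp
          consider "\<bar>v - u\<bar> \<le> h" | "v - u > h" | "u - v > h" by linarith
          then show ?thesis
          proof cases
            case 1 then show ?thesis using True hp by (intro exI[of _ u]) auto
          next
            case 2 then show ?thesis using True Suc.prems h0 hn by (intro exI[of _ "v - h"]) auto
          next
            case 3 then show ?thesis using True Suc.prems h0 hn by (intro exI[of _ "v + h"]) auto
          qed
        qed
        then obtain v' where v': "s0 < v'" "v' < t0" "\<bar>v' - u\<bar> \<le> h * real n" "\<bar>v - v'\<bar> \<le> h" by blast
        have "v' \<in> {s..t}" using v' s1s0 t1t0 s1t by auto
        then have "\<bar>\<pi> (F v) - \<pi> (F v')\<bar> \<le> B'" using far_step Suc.prems v' by blast
        with Suc.IH[OF v'(1-3)] show ?case by (simp add: algebra_simps)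
      qed
      define n where "n = nat \<lceil>(t1 - s1) / h\<rceil>"
      have len: "t1 - s1 \<ge> 0" using s1 t1 by simp
      have "(t1 - s1) / h \<ge> 0" using len h0 by simp
      then have n: "(t1 - s1) / h \<le> real n" "real n \<le> (t1 - s1) / h + 1"
        unfolding n_def by linarith+
      have hn: "t1 - s1 \<le> h * real n" using n(1) h0 by (simp add: field_simps)
      have h2: "h \<ge> 2" using lam B'1(1) mult_mono[of 1 lam 1 B'] unfolding h_def by linarith
      \<comment> \<open>\<open>v1\<close> and \<open>v2\<close> are points of the gap at parameter
        distance less than 3/2 from \<open>s1\<close> and \<open>t1\<close>, within reach of one
        step because \<open>h \<ge> 2\<close>.\<close>
      define v1 where "v1 = min u (s0 + 1 / 2)"
      define v2 where "v2 = max u (t0 - 1 / 2)"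
      have end1: "\<bar>\<pi> (F s1) - \<pi> (F u)\<bar> \<le> B' + B' * real n"
      proof -
        have "s0 < v1" "v1 < t0" "\<bar>v1 - s1\<bar> \<le> h" "\<bar>v1 - u\<bar> \<le> h * real n"
          using True s1 s1s0 t1t0 h2 hn by (auto simp: v1_def)
        then show ?thesis using far_step[of v1 s1] step[of v1 n] s1t by (simp add: abs_le_iff)
      qed
      have end2: "\<bar>\<pi> (F t1) - \<pi> (F u)\<bar> \<le> B' + B' * real n"
      proof -
        have "s0 < v2" "v2 < t0" "\<bar>v2 - t1\<bar> \<le> h" "\<bar>v2 - u\<bar> \<le> h * real n"
          using True t1 s1s0 t1t0 h2 hn by (auto simp: v2_def)
        then show ?thesis using far_step[of v2 t1] step[of v2 n] s1t by (simp add: abs_le_iff)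
      qed
      have Xst: "F s1 \<in> X" "F t1 \<in> X" "F u \<in> X" using X s1t u by auto
      have "1 / lam * \<bar>s1 - t1\<bar> - eps \<le> d (F s1) (F t1)" using lo s1t by blast
      also have "\<dots> \<le> d (F s1) p + (d p q + d q (F t1))"
        using tri[of "F s1" p "F t1"] tri[of p q "F t1"] Xst pX by linarith
      also have "\<dots> \<le> 2 * D + \<bar>\<pi> p - \<pi> q\<bar>"
        using p q geod[of p q] sym[of q "F t1"] Xst pX by linarith
      also have "\<dots> \<le> 4 * D + \<bar>\<pi> (F s1) - \<pi> (F t1)\<bar>"
        using lip[of "F s1" p] lip[of "F t1" q] p q Xst pX by linarith
      also have "\<dots> \<le> 4 * D + 2 * (B' + B' * real n)"
      proof -
        have "\<bar>\<pi> (F s1) - \<pi> (F t1)\<bar> \<le> \<bar>\<pi> (F s1) - \<pi> (F u)\<bar> + \<bar>\<pi> (F t1) - \<pi> (F u)\<bar>" by linarith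
        also have "\<dots> \<le> (B' + B' * real n) + (B' + B' * real n)" using end1 end2 by (rule add_mono)
        finally show ?thesis by simp
      qed
      also have "\<dots> \<le> 4 * D + 2 * (B' + B' * ((t1 - s1) / h + 1))"
        using n(2) B'1 by simp
      \<comment> \<open>Here \<open>2 * B' / h = 1 / (2 * lam)\<close>, so half of the lower bound
        \<open>(t1 - s1) / lam\<close> survives the comparison.\<close>
      also have "\<dots> = 4 * D + 4 * B' + (t1 - s1) / (2 * lam)"
        using B'1 lam by (simp add: h_def field_simps)
      finally have "(t1 - s1) / lam - eps \<le> 4 * D + 4 * B' + (t1 - s1) / (2 * lam)"
        using len by simp
      moreover have "(t1 - s1) / lam = (t1 - s1) / (2 * lam) + (t1 - s1) / (2 * lam)" by simp
      ultimately have "(t1 - s1) / (2 * lam) \<le> 4 * D + 4 * B' + eps" by linarith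
      then have "t1 - s1 \<le> 2 * lam * (4 * D + 4 * B' + eps)" using lam by (simp add: field_simps)
      also have "\<dots> \<le> T" unfolding T_def using D'0 lam by (intro mult_left_mono) auto
      finally have len_T: "\<bar>u - s1\<bar> \<le> T" using s1 t1 by simp
      have "d (F u) p \<le> d (F u) (F s1) + d (F s1) p" using Xst pX by (intro tri)
      also have "\<dots> \<le> lam * T + eps + D"
        using up[OF u s1t(1)] p(2) mult_left_mono[OF len_T, of lam] lam by linarith
      also have "\<dots> \<le> R" using D'0 by (simp add: R_def)
      finally show False using far p by auto
    qed
  qed
  with R0(1) show ?thesis by (intro exI[of _ R] conjI allI impI ballI) (simp, metis)
qed

section \<open>The Birkhoff metric of a proper cone\<close>

text \<open>The inequality in \<open>pointed\<close> bounds the slice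
  \<open>w \<bullet> v = 1\<close> of the cone. It passes to the closure and excludes lines
  there.\<close>

locale proper_cone =
  fixes C :: "'a::euclidean_space set" and w :: 'a
  assumes open_C: "open C"
    and C_add: "x \<in> C \<Longrightarrow> y \<in> C \<Longrightarrow> x + y \<in> C"
    and C_scale: "c > 0 \<Longrightarrow> x \<in> C \<Longrightarrow> c *\<^sub>R x \<in> C"
    and zero_notin_C: "0 \<notin> C"
    and C_nonempty: "C \<noteq> {}"
    and pointed: "\<exists>M>0. \<forall>v\<in>C. norm v \<le> M * (w \<bullet> v)"
begin

abbreviation K :: "'a set" where "K \<equiv> closure C"

lemma C_K: "x \<in> C \<Longrightarrow> x \<in> K"
  using closure_subset by blast

lemma K_add: "x \<in> K \<Longrightarrow> y \<in> K \<Longrightarrow> x + y \<in> K"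
proof -
  assume "x \<in> K" "y \<in> K"
  then obtain f g where "\<And>n. f n \<in> C" "f \<longlonglongrightarrow> x" "\<And>n. g n \<in> C" "g \<longlonglongrightarrow> y"
    unfolding closure_sequential by blast
  then show ?thesis
    unfolding closure_sequential by (intro exI[of _ "\<lambda>n. f n + g n"]) (auto intro: C_add tendsto_add)
qed

lemma zero_K: "0 \<in> K"
proof -
  obtain u where "u \<in> C" using C_nonempty by blast
  moreover have "(\<lambda>n. inverse (real (Suc n)) *\<^sub>R u) \<longlonglongrightarrow> 0 *\<^sub>R u"
    by (intro tendsto_scaleR LIMSEQ_inverse_real_of_nat tendsto_const)
  ultimately show ?thesis
    unfolding closure_sequential
    by (intro exI[of _ "\<lambda>n. inverse (real (Suc n)) *\<^sub>R u"]) (auto intro: C_scale)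
qed

lemma K_scale: "c \<ge> 0 \<Longrightarrow> x \<in> K \<Longrightarrow> c *\<^sub>R x \<in> K"
proof -
  assume c: "c \<ge> 0" and "x \<in> K"
  then obtain f where f: "\<And>n. f n \<in> C" "f \<longlonglongrightarrow> x"
    unfolding closure_sequential by blast
  show ?thesis
  proof (cases "c = 0")
    case True then show ?thesis by (simp add: zero_K)
  next
    case False
    then show ?thesis
      unfolding closure_sequential using f c
      by (intro exI[of _ "\<lambda>n. c *\<^sub>R f n"]) (auto intro: C_scale tendsto_intros)
  qed
qed

text \<open>Approximate \<open>y\<close> by a point \<open>y'\<close> of \<open>C\<close> and shift
  the small error \<open>y - y'\<close> onto \<open>x\<close>, which has room for it.\<close>

lemma C_K_add: "x \<in> C \<Longrightarrow> y \<in> K \<Longrightarrow> x + y \<in> C"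
proof -
  assume x: "x \<in> C" and y: "y \<in> K"
  obtain e where e: "e > 0" "ball x e \<subseteq> C" using open_C x open_contains_ball by blast
  obtain y' where y': "y' \<in> C" "dist y' y < e" using y e closure_approachable by blast
  have "x + (y - y') \<in> C" using e(2) y'(2) by (auto simp: dist_norm subset_iff norm_minus_commute)
  from C_add[OF this y'(1)] show ?thesis by simp
qed

lemma K_C_add: "x \<in> K \<Longrightarrow> y \<in> C \<Longrightarrow> x + y \<in> C"
  using C_K_add by (metis add.commute)

lemma K_pointed: "\<exists>M>0. \<forall>v\<in>K. norm v \<le> M * (w \<bullet> v)"
proof -
  obtain M where M: "M > 0" "\<And>v. v \<in> C \<Longrightarrow> norm v \<le> M * (w \<bullet> v)" using pointed by blast
  have "closed {v. norm v \<le> M * (w \<bullet> v)}"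
    by (intro closed_Collect_le continuous_intros)
  then have "K \<subseteq> {v. norm v \<le> M * (w \<bullet> v)}"
    by (rule closure_minimal[rotated]) (use M in auto)
  then show ?thesis using M(1) by auto
qed

lemma K_antisym:
  assumes "x \<in> K" "- x \<in> K" shows "x = 0"
proof -
  obtain M where M: "M > 0" "\<And>v. v \<in> K \<Longrightarrow> norm v \<le> M * (w \<bullet> v)" using K_pointed by blast
  from M(2)[OF assms(1)] M(2)[OF assms(2)] have "norm x + norm x \<le> 0" by (smt (verit) inner_minus_right mult_minus_right norm_minus_cancel)
  then show ?thesis by simp
qed

text \<open>Normality of the cone: \<open>w\<close> is monotone for the order of \<open>K\<close>
  and dominates the norm on \<open>K\<close>.\<close>

lemma K_mono_norm: "\<exists>N>0. \<forall>x y. x \<in> K \<longrightarrow> y - x \<in> K \<longrightarrow> norm x \<le> N * norm y"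
proof -
  obtain M where M: "M > 0" "\<And>v. v \<in> K \<Longrightarrow> norm v \<le> M * (w \<bullet> v)" using K_pointed by blast
  have "norm x \<le> (M * norm w + 1) * norm y" if "x \<in> K" "y - x \<in> K" for x y
  proof -
    have "0 \<le> M * (w \<bullet> (y - x))" using M(2)[OF that(2)] norm_ge_zero order_trans by blast
    then have "norm x \<le> M * (w \<bullet> y)"
      using M(2)[OF that(1)] by (simp add: inner_diff_right right_diff_distrib)
    also have "\<dots> \<le> M * (norm w * norm y)"
      using M(1) norm_cauchy_schwarz by (simp add: mult_left_mono)
    also have "\<dots> \<le> (M * norm w + 1) * norm y" by (simp add: algebra_simps)
    finally show ?thesis .
  qed
  moreover have "M * norm w + 1 > 0" using M(1) by (simp add: add_nonneg_pos)
  ultimately show ?thesis by blast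
qed

text \<open>A ball around \<open>u\<close> inside \<open>C\<close> absorbs every direction after
  rescaling. This turns norm bounds into bounds in the cone order.\<close>

lemma order_unit:
  assumes "u \<in> C"
  shows "\<exists>M>0. \<forall>v. (M * norm v) *\<^sub>R u - v \<in> K"
proof -
  obtain e where e: "e > 0" "ball u e \<subseteq> C" using open_C assms open_contains_ball by blast
  have "(2 / e * norm v) *\<^sub>R u - v \<in> K" for v
  proof (cases "v = 0")
    case True then show ?thesis by (simp add: zero_K)
  next
    case False
    define c where "c = 2 / e * norm v"
    have c: "c > 0" using False e(1) by (simp add: c_def)
    have "norm (inverse c *\<^sub>R v) = e / 2"
      using False e(1) by (simp add: c_def)
    then have "u - inverse c *\<^sub>R v \<in> C"
      using e by (auto simp: subset_iff dist_norm)
    then have "c *\<^sub>R (u - inverse c *\<^sub>R v) \<in> K" using c by (intro C_K C_scale)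
    then show ?thesis
      using c unfolding c_def[symmetric] by (simp add: scaleR_right_diff_distrib)
  qed
  then show ?thesis using e(1) by (intro exI[of _ "2/e"]) auto
qed

text \<open>Adding multiples of \<open>x\<close> and \<open>y\<close> raises both coefficients to
  their maximum without leaving \<open>C\<close>. Hence the single sum \<open>x + y\<close> decides
  whether any nonnegative combination can lie in \<open>C\<close>.\<close>

lemma add_in_C:
  assumes "x \<in> K" "y \<in> K" "s \<ge> 0" "t \<ge> 0" "s *\<^sub>R x + t *\<^sub>R y \<in> C"
  shows "x + y \<in> C"
proof -
  define c where "c = max s t"
  have "\<not> (s = 0 \<and> t = 0)" using assms(5) zero_notin_C by auto
  then have c: "c > 0" using assms(3,4) by (auto simp: c_def)
  have "(s *\<^sub>R x + t *\<^sub>R y) + ((c - s) *\<^sub>R x + (c - t) *\<^sub>R y) \<in> C"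
    by (intro C_K_add K_add K_scale assms) (auto simp: c_def)
  then have "c *\<^sub>R (x + y) \<in> C" by (simp add: algebra_simps)
  from C_scale[of "inverse c", OF _ this] c show ?thesis by simp
qed

text \<open>\<open>near r x y\<close> will say that the points of projective space represented by \<open>x\<close> and \<open>y\<close> are at
  Hilbert distance at most \<open>r\<close>.\<close>

definition near :: "real \<Rightarrow> 'a \<Rightarrow> 'a \<Rightarrow> bool" where
  "near r x y \<longleftrightarrow> (\<exists>\<alpha>>0. \<exists>\<beta>. y - \<alpha> *\<^sub>R x \<in> K \<and> \<beta> *\<^sub>R x - y \<in> K \<and> \<beta> \<le> exp (2 * r) * \<alpha>)"

lemma bounds_le:
  assumes "x \<in> C" "y - \<alpha> *\<^sub>R x \<in> K" "\<beta> *\<^sub>R x - y \<in> K"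
  shows "\<alpha> \<le> \<beta>"
proof (rule ccontr)
  assume n: "\<not> \<alpha> \<le> \<beta>"
  have "(y - \<alpha> *\<^sub>R x) + (\<beta> *\<^sub>R x - y) \<in> K" using assms by (intro K_add)
  then have "- ((\<alpha> - \<beta>) *\<^sub>R x) \<in> K" by (simp add: algebra_simps)
  moreover have "(\<alpha> - \<beta>) *\<^sub>R x \<in> C" using n assms by (intro C_scale) auto
  ultimately have "(\<alpha> - \<beta>) *\<^sub>R x = 0" using K_antisym C_K by blast
  then show False using \<open>(\<alpha> - \<beta>) *\<^sub>R x \<in> C\<close> zero_notin_C by metis
qed

lemma near_nonneg:
  assumes "x \<in> C" "near r x y" shows "r \<ge> 0"
proof -
  obtain \<alpha> \<beta> where 1: "\<alpha> > 0" "y - \<alpha> *\<^sub>R x \<in> K" "\<beta> *\<^sub>R x - y \<in> K" "\<beta> \<le> exp (2 * r) * \<alpha>"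
    using assms(2) unfolding near_def by blast
  have "1 * \<alpha> \<le> exp (2 * r) * \<alpha>" using bounds_le[OF assms(1) 1(2,3)] 1(4) by simp
  then have "1 \<le> exp (2 * r)" using 1(1) mult_le_cancel_right_pos by blast
  then show ?thesis by simp
qed

lemma near_refl: "r \<ge> 0 \<Longrightarrow> near r x x"
  unfolding near_def by (intro exI[of _ 1] conjI) (auto simp: zero_K)

lemma near_sym:
  assumes "x \<in> C" "near r x y" shows "near r y x"
proof -
  obtain \<alpha> \<beta> where 1: "\<alpha> > 0" "y - \<alpha> *\<^sub>R x \<in> K" "\<beta> *\<^sub>R x - y \<in> K" "\<beta> \<le> exp (2 * r) * \<alpha>"
    using assms(2) unfolding near_def by blast
  have b: "\<beta> > 0" using bounds_le[OF assms(1) 1(2,3)] 1(1) by simp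
  have "inverse \<beta> *\<^sub>R (\<beta> *\<^sub>R x - y) \<in> K" "inverse \<alpha> *\<^sub>R (y - \<alpha> *\<^sub>R x) \<in> K"
    using 1 b by (intro K_scale; simp)+
  then have "x - inverse \<beta> *\<^sub>R y \<in> K" "inverse \<alpha> *\<^sub>R y - x \<in> K"
    using 1(1) b by (simp_all add: algebra_simps)
  moreover have "inverse \<alpha> \<le> exp (2 * r) * inverse \<beta>"
    using 1(1,4) b by (simp add: field_simps)
  ultimately show ?thesis unfolding near_def using b by (metis inverse_positive_iff_positive)
qed

lemma near_trans:
  assumes "x \<in> C" "near r x y" "near s y z" shows "near (r + s) x z"
proof -
  obtain \<alpha> \<beta> where 1: "\<alpha> > 0" "y - \<alpha> *\<^sub>R x \<in> K" "\<beta> *\<^sub>R x - y \<in> K" "\<beta> \<le> exp (2 * r) * \<alpha>"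
    using assms(2) unfolding near_def by blast
  obtain \<alpha>' \<beta>' where 2: "\<alpha>' > 0" "z - \<alpha>' *\<^sub>R y \<in> K" "\<beta>' *\<^sub>R y - z \<in> K" "\<beta>' \<le> exp (2 * s) * \<alpha>'"
    using assms(3) unfolding near_def by blast
  have b: "\<beta> > 0" using bounds_le[OF assms(1) 1(2,3)] 1(1) by simp
  have "y = \<alpha> *\<^sub>R x + (y - \<alpha> *\<^sub>R x)" by simp
  then have "y \<in> C" using C_K_add[OF C_scale[OF 1(1) assms(1)] 1(2)] by simp
  then have b': "\<beta>' > 0" using bounds_le[OF _ 2(2,3)] 2(1) by simp
  have "(z - \<alpha>' *\<^sub>R y) + \<alpha>' *\<^sub>R (y - \<alpha> *\<^sub>R x) \<in> K" "\<beta>' *\<^sub>R (\<beta> *\<^sub>R x - y) + (\<beta>' *\<^sub>R y - z) \<in> K"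
    using 1 2 b' by (intro K_add K_scale; simp)+
  then have "z - (\<alpha>' * \<alpha>) *\<^sub>R x \<in> K" "(\<beta>' * \<beta>) *\<^sub>R x - z \<in> K" by (simp_all add: algebra_simps)
  moreover have "\<beta>' * \<beta> \<le> (exp (2 * s) * \<alpha>') * (exp (2 * r) * \<alpha>)"
    using 1 2 b b' by (intro mult_mono) auto
  moreover have "(exp (2 * s) * \<alpha>') * (exp (2 * r) * \<alpha>) = exp (2 * (r + s)) * (\<alpha>' * \<alpha>)"
    by (simp add: exp_add algebra_simps)
  ultimately show ?thesis unfolding near_def using 1(1) 2(1)
    by (metis mult_pos_pos)
qed

lemma near_scale:
  assumes "c > 0" "d > 0" "near r x y" shows "near r (c *\<^sub>R x) (d *\<^sub>R y)"
proof -
  obtain \<alpha> \<beta> where 1: "\<alpha> > 0" "y - \<alpha> *\<^sub>R x \<in> K" "\<beta> *\<^sub>R x - y \<in> K" "\<beta> \<le> exp (2 * r) * \<alpha>"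
    using assms(3) unfolding near_def by blast
  have "d *\<^sub>R (y - \<alpha> *\<^sub>R x) \<in> K" "d *\<^sub>R (\<beta> *\<^sub>R x - y) \<in> K" using 1 assms by (intro K_scale; simp)+
  then have "d *\<^sub>R y - (d * \<alpha> / c) *\<^sub>R c *\<^sub>R x \<in> K" "(d * \<beta> / c) *\<^sub>R c *\<^sub>R x - d *\<^sub>R y \<in> K"
    using assms by (simp_all add: algebra_simps)
  moreover have "d * \<beta> / c \<le> exp (2 * r) * (d * \<alpha> / c)"
    using 1(4) assms by (simp add: field_simps)
  moreover have "d * \<alpha> / c > 0" using assms 1(1) by simp
  ultimately show ?thesis unfolding near_def by blast
qed

text \<open>Adding \<open>s\<close> to both bounds brings their ratio no farther from 1: a point of
  the segment is no farther from \<open>x\<close> than \<open>y\<close> is.\<close>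

lemma near_combination:
  assumes "r \<ge> 0" "near r x y" "s > 0" "t > 0" shows "near r x (s *\<^sub>R x + t *\<^sub>R y)"
proof -
  obtain \<alpha> \<beta> where 1: "\<alpha> > 0" "y - \<alpha> *\<^sub>R x \<in> K" "\<beta> *\<^sub>R x - y \<in> K" "\<beta> \<le> exp (2 * r) * \<alpha>"
    using assms unfolding near_def by blast
  have "t *\<^sub>R (y - \<alpha> *\<^sub>R x) \<in> K" "t *\<^sub>R (\<beta> *\<^sub>R x - y) \<in> K" using 1 assms by (intro K_scale; simp)+
  then have "(s *\<^sub>R x + t *\<^sub>R y) - (s + t * \<alpha>) *\<^sub>R x \<in> K" "(s + t * \<beta>) *\<^sub>R x - (s *\<^sub>R x + t *\<^sub>R y) \<in> K"
    by (simp_all add: algebra_simps)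
  moreover have "s + t * \<beta> \<le> exp (2 * r) * (s + t * \<alpha>)"
  proof -
    have "t * \<beta> \<le> t * (exp (2 * r) * \<alpha>)" using 1(4) assms by simp
    moreover have "1 * s \<le> exp (2 * r) * s" using assms by (intro mult_right_mono) auto
    ultimately show ?thesis by (simp add: algebra_simps)
  qed
  moreover have "s + t * \<alpha> > 0" using assms 1(1) by (simp add: add_pos_pos)
  ultimately show ?thesis unfolding near_def by blast
qed

text \<open>Close to \<open>u\<close>, the order unit property confines \<open>v\<close> between 1/2
  and 3/2 times \<open>u\<close>, and the ratio 3 is below \<open>exp 2\<close>. The radius 1 is a
  convenient choice, shared with \<open>segment_near_axis\<close>.\<close>

lemma near_open:
  assumes "u \<in> C"
  shows "\<exists>e>0. \<forall>v. norm (v - u) < e \<longrightarrow> near 1 v u"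
proof -
  obtain M where M: "M > 0" "\<And>v. (M * norm v) *\<^sub>R u - v \<in> K" using order_unit[OF assms] by blast
  have "near 1 v u" if "norm (v - u) < 1 / (2 * M)" for v
  proof -
    have l: "M * norm (v - u) \<le> 1/2" using that M(1) by (simp add: field_simps)
    have A: "(1/2) *\<^sub>R u - z \<in> K" if "norm z = norm (v - u)" for z
    proof -
      have "((M * norm z) *\<^sub>R u - z) + (1/2 - M * norm z) *\<^sub>R u \<in> K"
        by (intro K_add K_scale M(2) C_K[OF assms]) (use l that in simp)
      then show ?thesis by (simp add: algebra_simps)
    qed
    have "(1/2) *\<^sub>R u - (v - u) \<in> K" "(1/2) *\<^sub>R u - (u - v) \<in> K"
      using A[of "v - u"] A[of "u - v"] by (auto simp: norm_minus_commute)
    moreover have "(1/2) *\<^sub>R u + u = (3/2) *\<^sub>R u" "u - (1/2) *\<^sub>R u = (1/2) *\<^sub>R u"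
      using scaleR_left_distrib[of "1/2" 1 u] scaleR_left_diff_distrib[of 1 "1/2" u] by simp_all
    moreover have "(1/2) *\<^sub>R u - (v - u) = ((1/2) *\<^sub>R u + u) - v" "(1/2) *\<^sub>R u - (u - v) = v - (u - (1/2) *\<^sub>R u)"
      by (simp_all add: add_diff_eq diff_diff_eq2)
    ultimately have "(3/2) *\<^sub>R u - v \<in> K" "v - (1/2) *\<^sub>R u \<in> K"
      by metis+
    moreover have "(3/2::real) \<le> exp (2 * 1) * (1/2)" using exp_ge_add_one_self[of 2] by simp
    ultimately have "near 1 u v" unfolding near_def
      by (intro exI[of _ "1/2"] conjI exI[of _ "3/2"]) auto
    then show ?thesis using near_sym[OF assms] by blast
  qed
  then show ?thesis using M(1) by (intro exI[of _ "1 / (2*M)"]) auto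
qed

text \<open>Apply \<open>f\<close> to the upper bound and \<open>g\<close> to the lower one: the
  quotient \<open>f / g\<close> grows by a factor of at most \<open>\<beta> / \<alpha>\<close>. This
  makes half its logarithm 1-Lipschitz.\<close>

lemma near_functional:
  assumes n: "near r x y" and x: "x \<in> C" and f: "\<And>z. z \<in> K \<Longrightarrow> f \<bullet> z \<ge> 0" "\<And>z. z \<in> C \<Longrightarrow> f \<bullet> z > 0"
    and g: "\<And>z. z \<in> K \<Longrightarrow> g \<bullet> z \<ge> 0" "\<And>z. z \<in> C \<Longrightarrow> g \<bullet> z > 0" and y: "y \<in> C"
  shows "ln ((f \<bullet> y) / (g \<bullet> y)) \<le> ln ((f \<bullet> x) / (g \<bullet> x)) + 2 * r"
proof -
  obtain \<alpha> \<beta> where 1: "\<alpha> > 0" "y - \<alpha> *\<^sub>R x \<in> K" "\<beta> *\<^sub>R x - y \<in> K" "\<beta> \<le> exp (2 * r) * \<alpha>"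
    using n unfolding near_def by blast
  have p: "f \<bullet> x > 0" "g \<bullet> x > 0" "f \<bullet> y > 0" "g \<bullet> y > 0" using f g x y by auto
  have "\<beta> * (f \<bullet> x) \<ge> f \<bullet> y" using f(1)[OF 1(3)] by (simp add: inner_diff_right)
  moreover have "\<alpha> * (g \<bullet> x) \<le> g \<bullet> y" using g(1)[OF 1(2)] by (simp add: inner_diff_right)
  ultimately have "f \<bullet> y * (\<alpha> * (g \<bullet> x)) \<le> (\<beta> * (f \<bullet> x)) * (g \<bullet> y)"
    using p 1(1) by (intro mult_mono) auto
  also have "\<dots> \<le> (exp (2 * r) * \<alpha>) * (f \<bullet> x) * (g \<bullet> y)"
    using p 1(4) by (intro mult_right_mono) auto
  finally have "\<alpha> * (f \<bullet> y * (g \<bullet> x)) \<le> \<alpha> * (exp (2 * r) * (f \<bullet> x) * (g \<bullet> y))"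
    by (simp add: algebra_simps)
  then have "f \<bullet> y * (g \<bullet> x) \<le> exp (2 * r) * (f \<bullet> x) * (g \<bullet> y)" using 1(1) by simp
  then have "(f \<bullet> y) / (g \<bullet> y) \<le> ((f \<bullet> x) / (g \<bullet> x)) * exp (2 * r)"
    using p by (simp add: field_simps)
  then have "ln ((f \<bullet> y) / (g \<bullet> y)) \<le> ln (((f \<bullet> x) / (g \<bullet> x)) * exp (2 * r))"
    using p by (intro ln_mono) auto
  also have "\<dots> = ln ((f \<bullet> x) / (g \<bullet> x)) + 2 * r" using p by (subst ln_mult) auto
  finally show ?thesis .
qed

end

section \<open>Contraction onto the axis\<close>

text \<open>For \<open>a\<close> and \<open>z\<close> in \<open>K\<close>, \<open>a + z \<notin> C\<close> says that the projective segment from \<open>a\<close> to \<open>z\<close> lies in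
  the boundary (see \<open>add_in_C\<close>).\<close>

locale proper_cone_axis = proper_cone +
  fixes h h' :: "'a \<Rightarrow> 'a" and a b :: 'a and lam mu :: real
  assumes lin: "linear h" "linear h'"
    and inv: "\<And>x. h (h' x) = x" "\<And>x. h' (h x) = x"
    and h_C: "\<And>x. x \<in> C \<Longrightarrow> h x \<in> C" "\<And>x. x \<in> C \<Longrightarrow> h' x \<in> C"
    and ab: "a \<in> K" "b \<in> K" "a \<notin> C" "b \<notin> C" "a + b \<in> C"
    and eig: "h a = lam *\<^sub>R a" "h b = mu *\<^sub>R b" "mu > 0" "lam > mu"
    and no_half_triangle: "\<And>z. z \<in> K \<Longrightarrow> a + z \<notin> C \<Longrightarrow> b + z \<notin> C \<Longrightarrow> z = 0"
begin

text \<open>For the inverse map \<open>b\<close> has the larger eigenvalue, so the two ends exchange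
  roles. Everything shown for \<open>a\<close> thereby becomes available for
  \<open>b\<close>.\<close>

lemma swap: "proper_cone_axis C w h' h b a (1 / mu) (1 / lam)"
proof (unfold_locales)
  have l: "lam > 0" using eig by simp
  have "h' (h b) = h' (mu *\<^sub>R b)" "h' (h a) = h' (lam *\<^sub>R a)" using eig by simp_all
  then have "b = mu *\<^sub>R h' b" "a = lam *\<^sub>R h' a" using lin inv by (simp_all add: linear_scale)
  then have "(1 / mu) *\<^sub>R b = (1 / mu) *\<^sub>R mu *\<^sub>R h' b" "(1 / lam) *\<^sub>R a = (1 / lam) *\<^sub>R lam *\<^sub>R h' a" by metis+
  then show "h' b = (1 / mu) *\<^sub>R b" "h' a = (1 / lam) *\<^sub>R a" using l eig by simp_all
  show "1 / lam > 0" "1 / lam < 1 / mu" using l eig by (simp_all add: field_simps)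
qed (use lin inv h_C ab no_half_triangle in \<open>auto simp: add.commute linear_add linear_scale\<close>)

lemma h_K: "x \<in> K \<Longrightarrow> h x \<in> K"
proof -
  have "closed (h -` K)" using lin(1) by (intro closed_vimage linear_continuous_on) (auto simp: linear_conv_bounded_linear)
  then have "K \<subseteq> h -` K" by (rule closure_minimal[rotated]) (auto intro: h_C C_K)
  then show "x \<in> K \<Longrightarrow> h x \<in> K" by auto
qed

lemma h_C_iff: "h x \<in> C \<longleftrightarrow> x \<in> C"
  using h_C inv by metis

lemma h_K_iff: "h x \<in> K \<longleftrightarrow> x \<in> K"
  using h_K proper_cone_axis.h_K[OF swap] inv by metis

lemma a_nonzero: "a \<noteq> 0"
  using ab by auto

lemma C_axis: "s > 0 \<Longrightarrow> t > 0 \<Longrightarrow> s *\<^sub>R a + t *\<^sub>R b \<in> C"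
proof -
  assume st: "s > 0" "t > 0"
  have "min s t *\<^sub>R (a + b) + ((s - min s t) *\<^sub>R a + (t - min s t) *\<^sub>R b) \<in> C"
    by (intro C_K_add C_scale K_add K_scale ab) (use st in auto)
  then show ?thesis by (simp add: algebra_simps)
qed

lemma hn_lin: "linear (h ^^ n)"
proof (induction n)
  case 0 then show ?case by (simp add: linear_iff)
next
  case (Suc n) then show ?case using linear_compose[OF Suc lin(1)] by (simp only: funpow.simps)
qed

lemma hn_a: "(h ^^ n) a = lam ^ n *\<^sub>R a" and hn_b: "(h ^^ n) b = mu ^ n *\<^sub>R b"
  using lin eig by (induction n) (auto simp: linear_scale algebra_simps)

lemma hn_inv: "(h ^^ n) ((h' ^^ n) x) = x"
proof (induction n arbitrary: x)
  case (Suc n)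
  have "(h ^^ Suc n) ((h' ^^ Suc n) x) = h ((h ^^ n) ((h' ^^ n) (h' x)))" by (simp add: funpow_swap1)
  then show ?case by (simp add: Suc inv)
qed simp

lemma hn_C: "(h ^^ n) x \<in> C \<longleftrightarrow> x \<in> C"
  using h_C_iff by (induction n) auto

lemma hn_K: "(h ^^ n) x \<in> K \<longleftrightarrow> x \<in> K"
  using h_K_iff by (induction n) auto

text \<open>In the cone order \<open>v\<close> is at most a multiple of \<open>a + b\<close>, and
  \<open>h ^^ n\<close> scales \<open>a\<close> by \<open>lam ^ n\<close> and \<open>b\<close> by
  the smaller \<open>mu ^ n\<close>. Normality turns this into a norm bound.\<close>

lemma hn_growth: "\<exists>M>0. \<forall>n. \<forall>v\<in>K. norm ((h ^^ n) v) \<le> M * (lam ^ n * norm v)"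
proof -
  obtain M where M: "M > 0" "\<And>v. (M * norm v) *\<^sub>R (a + b) - v \<in> K" using order_unit[OF ab(5)] by blast
  obtain N where N: "N > 0" "\<And>x y. x \<in> K \<Longrightarrow> y - x \<in> K \<Longrightarrow> norm x \<le> N * norm y" using K_mono_norm by blast
  have l: "lam > 0" using eig by simp
  have "norm ((h ^^ n) v) \<le> (N * M * norm (a + b)) * (lam ^ n * norm v)" if v: "v \<in> K" for n v
  proof -
    have "(h ^^ n) ((M * norm v) *\<^sub>R (a + b) - v) \<in> K" using M(2) hn_K by blast
    then have "((M * norm v) *\<^sub>R (lam ^ n *\<^sub>R a + mu ^ n *\<^sub>R b) - (h ^^ n) v) \<in> K"
      using hn_lin[of n] by (simp add: linear_diff linear_add linear_scale hn_a hn_b)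
    moreover have "(M * norm v * (lam ^ n - mu ^ n)) *\<^sub>R b \<in> K"
      using M(1) eig ab by (intro K_scale mult_nonneg_nonneg) (auto intro: power_mono)
    ultimately have "((M * norm v) *\<^sub>R (lam ^ n *\<^sub>R a + mu ^ n *\<^sub>R b) - (h ^^ n) v)
        + (M * norm v * (lam ^ n - mu ^ n)) *\<^sub>R b \<in> K" by (rule K_add)
    then have "(M * norm v * lam ^ n) *\<^sub>R (a + b) - (h ^^ n) v \<in> K" by (simp add: algebra_simps)
    from N(2)[OF _ this] v hn_K have "norm ((h ^^ n) v) \<le> N * norm ((M * norm v * lam ^ n) *\<^sub>R (a + b))" by blast
    then show ?thesis unfolding norm_scaleR using M(1) l by (simp add: abs_mult mult_ac)
  qed
  moreover have "a + b \<noteq> 0" using ab(5) zero_notin_C by metis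
  then have "N * M * norm (a + b) > 0" using N(1) M(1) by simp
  ultimately show ?thesis by blast
qed

text \<open>Subtract from \<open>z\<close> the largest possible multiple of \<open>a\<close>.  If the remainder \<open>z0\<close> is nonzero, a
  limit \<open>u0\<close> of the normalized vectors \<open>h'\<^sup>n z0\<close> spans a half triangle with \<open>a\<close> and \<open>b\<close>: if
  \<open>b + u0\<close> were in \<open>C\<close>, then so would be \<open>b + u0 - \<delta> a\<close>, and applying \<open>h\<^sup>n\<close> would show that a
  further multiple of \<open>a\<close> can be subtracted from \<open>z0\<close>.\<close>

lemma facet_at_a:
  assumes z: "z \<in> K" "a + z \<notin> C"
  shows "\<exists>t. z = t *\<^sub>R a"
proof -
  define S where "S = {t. z - t *\<^sub>R a \<in> K}"
  have "closed ((\<lambda>t. z - t *\<^sub>R a) -` K)" by (intro closed_vimage continuous_intros) auto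
  then have cl: "closed S" by (simp add: S_def vimage_def)
  have S0: "0 \<in> S" using z by (simp add: S_def)
  obtain N where N: "N > 0" "\<And>x y. x \<in> K \<Longrightarrow> y - x \<in> K \<Longrightarrow> norm x \<le> N * norm y" using K_mono_norm by blast
  have "t \<le> N * norm z / norm a" if "t \<in> S" for t
  proof (cases "t \<ge> 0")
    case True
    have "norm (t *\<^sub>R a) \<le> N * norm z" using that True ab by (intro N K_scale) (auto simp: S_def)
    then show ?thesis using True a_nonzero by (simp add: field_simps)
  next
    case False
    then show ?thesis using N(1) by (smt (verit) divide_nonneg_nonneg mult_nonneg_nonneg norm_ge_zero)
  qed
  then have bdd: "bdd_above S" by (rule bdd_aboveI)
  define t0 where "t0 = Sup S"
  have t0S: "t0 \<in> S" unfolding t0_def using cl S0 bdd by (intro closed_contains_Sup) auto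
  have t00: "t0 \<ge> 0" unfolding t0_def using S0 bdd by (rule cSup_upper)
  define z0 where "z0 = z - t0 *\<^sub>R a"
  have z0K: "z0 \<in> K" using t0S by (simp add: z0_def S_def)
  have az0: "a + z0 \<notin> C"
  proof
    assume "a + z0 \<in> C"
    then have "(a + z0) + t0 *\<^sub>R a \<in> C" by (rule C_K_add[OF _ K_scale[OF t00 ab(1)]])
    then show False using z by (simp add: z0_def)
  qed
  have max: "z0 - t *\<^sub>R a \<notin> K" if "t > 0" for t
  proof
    assume "z0 - t *\<^sub>R a \<in> K"
    then have "t0 + t \<in> S" by (simp add: z0_def S_def algebra_simps)
    then have "t0 + t \<le> t0" unfolding t0_def using bdd by (rule cSup_upper)
    then show False using that by simp
  qed
  have "z0 = 0"
  proof (rule ccontr)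
    assume nz: "z0 \<noteq> 0"
    interpret s: proper_cone_axis C w h' h b a "1 / mu" "1 / lam" by (rule swap)
    define v where "v n = (h' ^^ n) z0" for n
    have hv: "(h ^^ n) (v n) = z0" for n
      by (simp add: v_def hn_inv)
    have vK: "v n \<in> K" for n using z0K s.hn_K by (simp add: v_def)
    have vn: "norm (v n) > 0" for n
    proof -
      have "v n \<noteq> 0" using hv[of n] nz linear_0[OF hn_lin[of n]] by auto
      then show ?thesis by simp
    qed
    define u where "u n = inverse (norm (v n)) *\<^sub>R v n" for n
    have hu: "(h ^^ n) (u n) = inverse (norm (v n)) *\<^sub>R z0" for n
      by (simp add: u_def linear_scale[OF hn_lin] hv)
    have "u n \<in> sphere 0 1 \<inter> K" for n using vn[of n] vK by (auto simp: u_def intro: K_scale)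
    moreover have "compact (sphere (0::'a) 1 \<inter> K)" by (intro compact_Int_closed) auto
    ultimately obtain u0 r where u0: "u0 \<in> sphere 0 1 \<inter> K" and r: "strict_mono (r :: nat \<Rightarrow> nat)" "(u \<circ> r) \<longlonglongrightarrow> u0"
      unfolding compact_def by metis
    \<comment> \<open>\<open>h ^^ n\<close> takes \<open>a\<close> and \<open>u n\<close> to
      positive multiples of \<open>a\<close> and \<open>z0\<close>, so the boundary segment from
      \<open>a\<close> to \<open>z0\<close> is inherited by every \<open>u n\<close> and then by the
      limit.\<close>
    have auC: "a + u n \<notin> C" for n
    proof
      assume "a + u n \<in> C"
      then have "(h ^^ n) (a + u n) \<in> C" using hn_C by blast
      then have "lam ^ n *\<^sub>R a + inverse (norm (v n)) *\<^sub>R z0 \<in> C" by (simp add: linear_add[OF hn_lin] hn_a hu)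
      then have "a + z0 \<in> C" using ab z0K eig by (intro add_in_C[of a z0]) auto
      then show False using az0 by simp
    qed
    have "(\<lambda>n. a + u (r n)) \<longlonglongrightarrow> a + u0" using r(2) by (intro tendsto_intros) (simp add: o_def)
    moreover have "closed (- C)" using open_C by (simp add: closed_def)
    ultimately have "a + u0 \<in> - C" using auC by (metis ComplI closed_sequentially)
    moreover have "b + u0 \<notin> C"
    proof
      assume bu: "b + u0 \<in> C"
      obtain e where e: "e > 0" "ball (b + u0) e \<subseteq> C" using open_C bu open_contains_ball by blast
      define \<delta> where "\<delta> = e / (2 * norm a)"
      have \<delta>: "\<delta> > 0" using e(1) a_nonzero by (simp add: \<delta>_def)
      have "norm (\<delta> *\<^sub>R a) < e" using e(1) a_nonzero by (simp add: \<delta>_def)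
      then have in_C: "b + u0 - \<delta> *\<^sub>R a \<in> C" using e(2) by (auto simp: subset_iff dist_norm)
      have "(\<lambda>n. b + u (r n) - \<delta> *\<^sub>R a) \<longlonglongrightarrow> b + u0 - \<delta> *\<^sub>R a"
        using r(2) by (intro tendsto_intros) (simp add: o_def)
      then have ev: "\<forall>\<^sub>F n in sequentially. b + u (r n) - \<delta> *\<^sub>R a \<in> C"
        using open_C in_C by (rule topological_tendstoD)
      obtain M where M: "M > 0" "\<And>n v. v \<in> K \<Longrightarrow> norm ((h ^^ n) v) \<le> M * (lam ^ n * norm v)"
        using hn_growth by blast
      \<comment> \<open>Since \<open>h ^^ n\<close> maps \<open>v n\<close> to \<open>z0\<close>,
        \<open>hn_growth\<close> bounds \<open>lam ^ n * norm (v n)\<close> below by \<kappa>. This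
        keeps the multiple of \<open>a\<close> that gets subtracted from shrinking to 0.\<close>
      define \<kappa> where "\<kappa> = norm z0 / M"
      have \<kappa>: "\<kappa> > 0" using nz M by (simp add: \<kappa>_def)
      have lpos: "lam > 0" using eig by simp
      have "z0 + (\<kappa> * (mu / lam) ^ n) *\<^sub>R b - (\<delta> * \<kappa>) *\<^sub>R a \<in> K" if "b + u n - \<delta> *\<^sub>R a \<in> C" for n
      proof -
        define W where "W = lam ^ n * norm (v n)"
        have W: "W > 0" "\<kappa> \<le> W" using M(2)[OF vK, of n n] M(1) vn lpos hv
          by (auto simp: W_def \<kappa>_def field_simps)
        have "(h ^^ n) (b + u n - \<delta> *\<^sub>R a) \<in> K" using that hn_C C_K by blast
        then have "mu ^ n *\<^sub>R b + inverse (norm (v n)) *\<^sub>R z0 - (\<delta> * lam ^ n) *\<^sub>R a \<in> K"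
          by (simp add: linear_add[OF hn_lin] linear_diff[OF hn_lin] linear_scale[OF hn_lin] hn_a hn_b hu)
        \<comment> \<open>After this scaling \<open>z0\<close> has coefficient
          \<open>\<kappa> / W \<le> 1\<close>, and the missing part of it is added back. The
          coefficient of \<open>b\<close> tends to 0 because \<open>mu < lam\<close>.\<close>
        then have "(\<kappa> / lam ^ n) *\<^sub>R (mu ^ n *\<^sub>R b + inverse (norm (v n)) *\<^sub>R z0 - (\<delta> * lam ^ n) *\<^sub>R a)
            + (1 - \<kappa> / W) *\<^sub>R z0 \<in> K"
          using \<kappa> lpos W z0K by (intro K_add K_scale) (auto simp: field_simps)
        moreover have "(\<kappa> / lam ^ n) *\<^sub>R (mu ^ n *\<^sub>R b + inverse (norm (v n)) *\<^sub>R z0 - (\<delta> * lam ^ n) *\<^sub>R a)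
            = (\<kappa> * (mu / lam) ^ n) *\<^sub>R b + (\<kappa> / W) *\<^sub>R z0 - (\<delta> * \<kappa>) *\<^sub>R a"
          using lpos by (simp add: scaleR_add_right scaleR_diff_right power_divide W_def field_simps)
        ultimately have "(\<kappa> * (mu / lam) ^ n) *\<^sub>R b + (\<kappa> / W) *\<^sub>R z0 - (\<delta> * \<kappa>) *\<^sub>R a + (1 - \<kappa> / W) *\<^sub>R z0 \<in> K"
          by (simp only:)
        moreover have "(\<kappa> * (mu / lam) ^ n) *\<^sub>R b + (\<kappa> / W) *\<^sub>R z0 - (\<delta> * \<kappa>) *\<^sub>R a + (1 - \<kappa> / W) *\<^sub>R z0
            = z0 + (\<kappa> * (mu / lam) ^ n) *\<^sub>R b - (\<delta> * \<kappa>) *\<^sub>R a"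
          by (simp add: scaleR_diff_left)
        ultimately show ?thesis by (simp only:)
      qed
      then have "\<forall>\<^sub>F n in sequentially. z0 + (\<kappa> * (mu / lam) ^ r n) *\<^sub>R b - (\<delta> * \<kappa>) *\<^sub>R a \<in> K"
        using ev by (rule eventually_mono[rotated]) blast
      moreover have "(\<lambda>n. (mu / lam) ^ n) \<longlonglongrightarrow> 0" using eig lpos by (intro LIMSEQ_realpow_zero) auto
      then have "(\<lambda>n. (mu / lam) ^ r n) \<longlonglongrightarrow> 0" using LIMSEQ_subseq_LIMSEQ[OF _ r(1)] by (force simp: o_def)
      then have "(\<lambda>n. z0 + (\<kappa> * (mu / lam) ^ r n) *\<^sub>R b - (\<delta> * \<kappa>) *\<^sub>R a) \<longlonglongrightarrow> z0 + (\<kappa> * 0) *\<^sub>R b - (\<delta> * \<kappa>) *\<^sub>R a"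
        by (intro tendsto_intros)
      ultimately have "z0 + (\<kappa> * 0) *\<^sub>R b - (\<delta> * \<kappa>) *\<^sub>R a \<in> K"
        by (intro Lim_in_closed_set[OF closed_closure]) auto
      then show False using max[of "\<delta> * \<kappa>"] \<delta> \<kappa> by simp
    qed
    ultimately have "u0 = 0" using no_half_triangle u0 by auto
    then show False using u0 by simp
  qed
  then show ?thesis by (auto simp: z0_def)
qed

end

section \<open>Positive functionals and supporting hyperplanes of the cone\<close>

context proper_cone
begin

text \<open>Take the order unit inequality at the vector \<open>v = f\<close> itself: the positive
  number \<open>f \<bullet> f\<close> is at most a positive multiple of
  \<open>f \<bullet> u\<close>.\<close>

lemma dual_pos:
  assumes "\<And>z. z \<in> K \<Longrightarrow> f \<bullet> z \<ge> 0" "f \<noteq> 0" "u \<in> C"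
  shows "f \<bullet> u > 0"
proof -
  obtain M where M: "M > 0" "\<And>v. (M * norm v) *\<^sub>R u - v \<in> K" using order_unit[OF assms(3)] by blast
  have "f \<bullet> f \<le> M * norm f * (f \<bullet> u)"
    using assms(1)[OF M(2)[of f]] by (simp add: inner_diff_right)
  moreover have "f \<bullet> f > 0" using assms(2) by simp
  ultimately have "M * norm f * (f \<bullet> u) > 0" by linarith
  moreover have "M * norm f > 0" using M(1) assms(2) by simp
  ultimately show ?thesis using zero_less_mult_pos by blast
qed

text \<open>The same test vector gives a bound uniform in \<open>f\<close>. Prescribing the value at
  one interior point thus confines positive functionals to a bounded set, which Brouwer's theorem
  requires.\<close>

lemma dual_norm_bound:
  assumes "u \<in> C"
  shows "\<exists>M>0. \<forall>f. (\<forall>z\<in>K. f \<bullet> z \<ge> 0) \<longrightarrow> norm f \<le> M * (f \<bullet> u)"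
proof -
  obtain M where M: "M > 0" "\<And>v. (M * norm v) *\<^sub>R u - v \<in> K" using order_unit[OF assms] by blast
  have "norm f \<le> M * (f \<bullet> u)" if f: "\<forall>z\<in>K. f \<bullet> z \<ge> 0" for f
  proof (cases "f = 0")
    case False
    have "f \<bullet> f \<le> M * norm f * (f \<bullet> u)"
      using f M(2)[of f] by (auto simp: inner_diff_right dest!: bspec)
    then have "norm f * norm f \<le> norm f * (M * (f \<bullet> u))"
      by (simp add: dot_square_norm power2_eq_square mult_ac)
    then show ?thesis using False by simp
  qed simp
  then show ?thesis using M(1) by blast
qed

lemma convex_C: "convex C"
proof (rule convexI)
  fix x y and u v :: real
  assume "x \<in> C" "y \<in> C" "0 \<le> u" "0 \<le> v" "u + v = 1"
  then show "u *\<^sub>R x + v *\<^sub>R y \<in> C"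
    by (cases "u = 0"; cases "v = 0") (auto intro!: C_add C_scale)
qed

text \<open>Homogeneity moves a separating hyperplane to the origin: a negative value of
  \<open>p\<close> would be unbounded below along a ray, and \<open>0 \<in> K\<close> gives
  \<open>c \<le> 0\<close>.\<close>

lemma supporting_functional:
  assumes "a \<in> K" "a \<notin> C"
  shows "\<exists>f. f \<noteq> 0 \<and> (\<forall>z\<in>K. f \<bullet> z \<ge> 0) \<and> f \<bullet> a = 0"
proof -
  obtain p c where p: "p \<noteq> 0" "p \<bullet> a \<le> c" "\<And>x. x \<in> C \<Longrightarrow> c \<le> p \<bullet> x"
    using separating_hyperplane_sets[of "{a}" C] convex_C C_nonempty assms(2) by auto
  have pos: "p \<bullet> x \<ge> 0" if x: "x \<in> C" for x
  proof (rule ccontr)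
    assume n: "\<not> p \<bullet> x \<ge> 0"
    define s where "s = (\<bar>c\<bar> + 1) / - (p \<bullet> x)"
    have "s > 0" using n by (simp add: s_def divide_pos_neg field_simps)
    from p(3)[OF C_scale[OF this x]] have "c \<le> s * (p \<bullet> x)" by simp
    also have "s * (p \<bullet> x) = - (\<bar>c\<bar> + 1)" using n by (simp add: s_def field_simps)
    finally show False by simp
  qed
  have "closed {x. p \<bullet> x \<ge> 0}" by (rule closed_halfspace_ge[of 0 p, simplified])
  then have "K \<subseteq> {x. p \<bullet> x \<ge> 0}" by (rule closure_minimal[rotated]) (use pos in auto)
  then have posK: "\<And>x. x \<in> K \<Longrightarrow> p \<bullet> x \<ge> 0" by auto
  have "closed {x. p \<bullet> x \<ge> c}" by (rule closed_halfspace_ge)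
  then have "K \<subseteq> {x. p \<bullet> x \<ge> c}" by (rule closure_minimal[rotated]) (use p(3) in auto)
  then have "c \<le> p \<bullet> 0" using zero_K by blast
  then have "p \<bullet> a = 0" using p(2) posK[OF assms(1)] by simp
  then show ?thesis using p(1) posK by blast
qed

end

context proper_cone_axis
begin

text \<open>Normalized supporting functionals at \<open>a\<close> form a compact convex set that \<open>adjoint h / mu\<close> maps
  to itself, so Brouwer's theorem provides an invariant one.\<close>

lemma invariant_functional:
  "\<exists>g. (\<forall>z\<in>K. g \<bullet> z \<ge> 0) \<and> g \<bullet> a = 0 \<and> g \<bullet> b = 1 \<and> (\<forall>z. g \<bullet> h z = mu * (g \<bullet> z))
    \<and> (\<forall>z\<in>K. g \<bullet> z = 0 \<longrightarrow> (\<exists>t. z = t *\<^sub>R a))"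
proof -
  define S where "S = {g. (\<forall>z\<in>K. g \<bullet> z \<ge> 0) \<and> g \<bullet> a = 0 \<and> g \<bullet> b = 1}"
  obtain p where p: "p \<noteq> 0" "\<forall>z\<in>K. p \<bullet> z \<ge> 0" "p \<bullet> a = 0"
    using supporting_functional[OF ab(1,3)] by blast
  have "p \<bullet> (a + b) > 0" using p ab(5) by (intro dual_pos) auto
  then have pb: "p \<bullet> b > 0" using p by (simp add: inner_add_right)
  have "inverse (p \<bullet> b) *\<^sub>R p \<in> S" using p pb by (auto simp: S_def)
  then have ne: "S \<noteq> {}" by blast
  have S_eq: "S = (\<Inter>z\<in>K. {g. 0 \<le> g \<bullet> z}) \<inter> {g. g \<bullet> a = 0} \<inter> {g. g \<bullet> b = 1}" by (auto simp: S_def)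
  have cl: "closed S" unfolding S_eq
    by (intro closed_Int closed_INT ballI closed_Collect_le closed_Collect_eq continuous_intros)
  have cv: "convex S"
    by (rule convexI) (auto simp: S_def inner_add_left)
  obtain M where M: "M > 0" "\<And>f. \<forall>z\<in>K. f \<bullet> z \<ge> 0 \<Longrightarrow> norm f \<le> M * (f \<bullet> (a + b))"
    using dual_norm_bound[OF ab(5)] by blast
  have "norm g \<le> M" if "g \<in> S" for g
    using M(2)[of g] that by (auto simp: S_def inner_add_right)
  then have "bounded S" using boundedI by blast
  then have cp: "compact S" using cl by (simp add: compact_eq_bounded_closed)
  \<comment> \<open>Dividing by \<open>mu\<close> restores the normalization at \<open>b\<close>, an
    eigenvector for \<open>mu\<close>. A fixed point of \<open>T\<close> is an eigenfunctional of
    \<open>h\<close> for \<open>mu\<close>.\<close>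
  define T where "T g = inverse mu *\<^sub>R adjoint h g" for g
  have T: "T g \<bullet> z = (g \<bullet> h z) / mu" for g z
    using adjoint_works[OF lin(1), of z g] by (simp add: T_def inner_commute field_simps)
  have "T ` S \<subseteq> S"
    using eig h_K by (auto simp: S_def T)
  moreover have "continuous_on S T"
    unfolding T_def by (intro continuous_intros linear_continuous_on)
      (use adjoint_linear[OF lin(1)] in \<open>simp add: linear_conv_bounded_linear\<close>)
  ultimately obtain g where g: "g \<in> S" "T g = g" using brouwer[OF cp cv ne] by blast
  have "g \<bullet> h z = mu * (g \<bullet> z)" for z using T[of g z] g(2) eig by (simp add: field_simps)
  \<comment> \<open>The functional is positive on \<open>C\<close> but vanishes at
    \<open>a + z\<close>, so \<open>facet_at_a\<close> applies. This is where the absence of half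
    triangles enters.\<close>
  moreover have "\<exists>t. z = t *\<^sub>R a" if z: "z \<in> K" "g \<bullet> z = 0" for z
  proof (rule facet_at_a[OF z(1)])
    show "a + z \<notin> C"
    proof
      assume "a + z \<in> C"
      then have "g \<bullet> (a + z) > 0" using g(1) by (intro dual_pos) (auto simp: S_def)
      then show False using g(1) z(2) by (simp add: S_def inner_add_right)
    qed
  qed
  ultimately show ?thesis using g(1) by (intro exI[of _ g]) (auto simp: S_def)
qed

lemma invariant_functional_pair:
  obtains f g where
    "\<And>z. z \<in> K \<Longrightarrow> f \<bullet> z \<ge> 0" "f \<bullet> a = 1" "f \<bullet> b = 0" "\<And>z. f \<bullet> h z = lam * (f \<bullet> z)"
    "\<And>z. z \<in> K \<Longrightarrow> f \<bullet> z = 0 \<Longrightarrow> \<exists>t. z = t *\<^sub>R b"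
    "\<And>z. z \<in> K \<Longrightarrow> g \<bullet> z \<ge> 0" "g \<bullet> a = 0" "g \<bullet> b = 1" "\<And>z. g \<bullet> h z = mu * (g \<bullet> z)"
    "\<And>z. z \<in> K \<Longrightarrow> g \<bullet> z = 0 \<Longrightarrow> \<exists>t. z = t *\<^sub>R a"
    "\<And>z. z \<in> C \<Longrightarrow> f \<bullet> z > 0" "\<And>z. z \<in> C \<Longrightarrow> g \<bullet> z > 0"
proof -
  obtain g where g: "\<And>z. z \<in> K \<Longrightarrow> g \<bullet> z \<ge> 0" "g \<bullet> a = 0" "g \<bullet> b = 1" "\<And>z. g \<bullet> h z = mu * (g \<bullet> z)"
    "\<And>z. z \<in> K \<Longrightarrow> g \<bullet> z = 0 \<Longrightarrow> \<exists>t. z = t *\<^sub>R a" using invariant_functional by blast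
  obtain f where f: "\<And>z. z \<in> K \<Longrightarrow> f \<bullet> z \<ge> 0" "f \<bullet> a = 1" "f \<bullet> b = 0" "\<And>z. f \<bullet> h' z = (1 / lam) * (f \<bullet> z)"
    "\<And>z. z \<in> K \<Longrightarrow> f \<bullet> z = 0 \<Longrightarrow> \<exists>t. z = t *\<^sub>R b"
    using proper_cone_axis.invariant_functional[OF swap] by blast
  have "f \<bullet> h z = lam * (f \<bullet> z)" for z using f(4)[of "h z"] inv eig by (simp add: field_simps)
  moreover have "f \<noteq> 0" "g \<noteq> 0" using f(2) g(3) by auto
  ultimately show ?thesis using that[of f g] f g dual_pos by blast
qed

section \<open>Long segments pass near the axis\<close>

text \<open>The free positive coefficients on both sides make the relation independent of the
  vectors chosen to represent projective points.\<close>

definition segment_near_axis :: "'a \<Rightarrow> 'a \<Rightarrow> bool" where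
  "segment_near_axis x y \<longleftrightarrow> (\<exists>s>0. \<exists>t>0. \<exists>c>0. \<exists>d>0. near 1 (s *\<^sub>R x + t *\<^sub>R y) (c *\<^sub>R a + d *\<^sub>R b))"

lemma near_h: "near r x y \<Longrightarrow> near r (h x) (h y)"
proof -
  assume "near r x y"
  then obtain \<alpha> \<beta> where 1: "\<alpha> > 0" "y - \<alpha> *\<^sub>R x \<in> K" "\<beta> *\<^sub>R x - y \<in> K" "\<beta> \<le> exp (2 * r) * \<alpha>"
    unfolding near_def by blast
  have "h y - \<alpha> *\<^sub>R h x \<in> K" "\<beta> *\<^sub>R h x - h y \<in> K"
    using h_K[OF 1(2)] h_K[OF 1(3)] lin(1) by (simp_all add: linear_diff linear_scale)
  then show ?thesis unfolding near_def using 1 by blast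
qed

lemma segment_near_axis_h: "segment_near_axis x y \<Longrightarrow> segment_near_axis (h x) (h y)"
proof -
  assume "segment_near_axis x y"
  then obtain s t c d where 1: "s > 0" "t > 0" "c > 0" "d > 0" "near 1 (s *\<^sub>R x + t *\<^sub>R y) (c *\<^sub>R a + d *\<^sub>R b)"
    unfolding segment_near_axis_def by blast
  have "near 1 (s *\<^sub>R h x + t *\<^sub>R h y) ((c * lam) *\<^sub>R a + (d * mu) *\<^sub>R b)"
    using near_h[OF 1(5)] lin(1) eig by (simp add: linear_add linear_scale)
  moreover have "c * lam > 0" "d * mu > 0" using 1 eig by auto
  ultimately show ?thesis unfolding segment_near_axis_def using 1 by blast
qed

lemma segment_near_axis_sym: "segment_near_axis x y \<Longrightarrow> segment_near_axis y x"
  unfolding segment_near_axis_def by (metis add.commute)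

text \<open>\<open>h\<close> preserves both the cone order and the axis; the converse is the same
  fact for the inverse, obtained through \<open>swap\<close>.\<close>

lemma segment_near_axis_hn: "segment_near_axis ((h ^^ n) x) ((h ^^ n) y) \<longleftrightarrow> segment_near_axis x y"
proof -
  have "segment_near_axis (h x) (h y) \<longleftrightarrow> segment_near_axis x y" for x y
  proof
    assume "segment_near_axis (h x) (h y)"
    then have "proper_cone_axis.segment_near_axis C b a (h x) (h y)"
      unfolding segment_near_axis_def proper_cone_axis.segment_near_axis_def[OF swap] by (metis add.commute)
    from proper_cone_axis.segment_near_axis_h[OF swap this]
    show "segment_near_axis x y"
      unfolding segment_near_axis_def proper_cone_axis.segment_near_axis_def[OF swap] inv by (metis add.commute)
  qed (rule segment_near_axis_h)
  then show ?thesis by (induction n) auto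
qed

lemma positive_on_axis_ray:
  assumes "t *\<^sub>R a \<in> K" "t \<noteq> 0" shows "t > 0"
proof (rule ccontr)
  assume "\<not> t > 0"
  then have "t < 0" using assms by simp
  then have "inverse (- t) *\<^sub>R (t *\<^sub>R a) \<in> K" by (intro K_scale assms(1)) auto
  then have "- a \<in> K" using assms by simp
  then show False using K_antisym ab a_nonzero by blast
qed

text \<open>For a sequence of counterexamples, the normalized vectors subconverge. Boundedness of
  \<open>f\<close> and \<open>g\<close> on unit vectors makes \<open>g\<close> vanish at the first
  limit and \<open>f\<close> at the second, so the limits lie on the rays of \<open>a\<close> and
  \<open>b\<close>. Their sum is an axis point in \<open>C\<close>, and \<open>near_open\<close>
  contradicts the choice of the sequence.\<close>

lemma segment_near_axis_of_ends:
  assumes g: "\<And>z. z \<in> K \<Longrightarrow> g \<bullet> z = 0 \<Longrightarrow> \<exists>t. z = t *\<^sub>R a"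
    and f: "\<And>z. z \<in> K \<Longrightarrow> f \<bullet> z = 0 \<Longrightarrow> \<exists>t. z = t *\<^sub>R b"
    and pos: "\<And>z. z \<in> C \<Longrightarrow> f \<bullet> z > 0" "\<And>z. z \<in> C \<Longrightarrow> g \<bullet> z > 0"
  shows "\<exists>B>0. \<forall>x\<in>C. \<forall>y\<in>C. f \<bullet> x \<ge> B * (g \<bullet> x) \<longrightarrow> g \<bullet> y \<ge> B * (f \<bullet> y) \<longrightarrow> segment_near_axis x y"
proof (rule ccontr)
  assume "\<not> ?thesis"
  then have "\<forall>n::nat. \<exists>x y. x \<in> C \<and> y \<in> C \<and> f \<bullet> x \<ge> real (Suc n) * (g \<bullet> x) \<and> g \<bullet> y \<ge> real (Suc n) * (f \<bullet> y) \<and> \<not> segment_near_axis x y"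
    by (metis of_nat_0_less_iff zero_less_Suc)
  then obtain x y where xy: "\<And>n. x n \<in> C" "\<And>n. y n \<in> C" "\<And>n. f \<bullet> x n \<ge> real (Suc n) * (g \<bullet> x n)"
    "\<And>n. g \<bullet> y n \<ge> real (Suc n) * (f \<bullet> y n)" "\<And>n. \<not> segment_near_axis (x n) (y n)" by metis
  define X where "X n = inverse (norm (x n)) *\<^sub>R x n" for n
  define Y where "Y n = inverse (norm (y n)) *\<^sub>R y n" for n
  have nz: "norm (x n) > 0" "norm (y n) > 0" for n using xy zero_notin_C by (metis zero_less_norm_iff)+
  have XC: "X n \<in> C" "Y n \<in> C" for n using xy nz by (auto simp: X_def Y_def intro!: C_scale)
  have n1: "norm (X n) = 1" "norm (Y n) = 1" for n using nz[of n] by (simp_all add: X_def Y_def)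
  have fX: "g \<bullet> X n \<le> norm f * inverse (real (Suc n))" for n
  proof -
    have "inverse (norm (x n)) * (real (Suc n) * (g \<bullet> x n)) \<le> inverse (norm (x n)) * (f \<bullet> x n)"
      using xy(3) nz by (intro mult_left_mono) auto
    then have "real (Suc n) * (g \<bullet> X n) \<le> f \<bullet> X n" by (simp add: X_def mult_ac)
    also have "\<dots> \<le> norm f" using norm_cauchy_schwarz[of f "X n"] n1 by simp
    finally show ?thesis by (simp add: field_simps)
  qed
  have gY: "f \<bullet> Y n \<le> norm g * inverse (real (Suc n))" for n
  proof -
    have "inverse (norm (y n)) * (real (Suc n) * (f \<bullet> y n)) \<le> inverse (norm (y n)) * (g \<bullet> y n)"
      using xy(4) nz by (intro mult_left_mono) auto
    then have "real (Suc n) * (f \<bullet> Y n) \<le> g \<bullet> Y n" by (simp add: Y_def mult_ac)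
    also have "\<dots> \<le> norm g" using norm_cauchy_schwarz[of g "Y n"] n1 by simp
    finally show ?thesis by (simp add: field_simps)
  qed
  have "compact ((sphere (0::'a) 1 \<inter> K) \<times> (sphere (0::'a) 1 \<inter> K))"
    by (intro compact_Times compact_Int_closed) auto
  moreover have "(X n, Y n) \<in> (sphere 0 1 \<inter> K) \<times> (sphere 0 1 \<inter> K)" for n using n1 XC C_K by auto
  ultimately obtain l r where l: "l \<in> (sphere (0::'a) 1 \<inter> K) \<times> (sphere (0::'a) 1 \<inter> K)"
    and r: "strict_mono (r :: nat \<Rightarrow> nat)" "((\<lambda>n. (X n, Y n)) \<circ> r) \<longlonglongrightarrow> l"
    unfolding compact_def by (metis (no_types, lifting))
  obtain u v where uv: "l = (u, v)" by (cases l)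
  have lim: "(\<lambda>n. X (r n)) \<longlonglongrightarrow> u" "(\<lambda>n. Y (r n)) \<longlonglongrightarrow> v"
    using tendsto_fst[OF r(2)] tendsto_snd[OF r(2)] by (simp_all add: uv o_def)
  have z: "(\<lambda>n. c * inverse (real (Suc (r n)))) \<longlonglongrightarrow> c * 0" for c
    using LIMSEQ_subseq_LIMSEQ[OF LIMSEQ_inverse_real_of_nat r(1)] by (intro tendsto_intros) (simp add: o_def)
  have "g \<bullet> u \<le> norm f * 0"
    by (rule tendsto_le[OF _ z tendsto_inner[OF tendsto_const lim(1)]]) (use fX in auto)
  moreover have "g \<bullet> u \<ge> 0"
    by (rule tendsto_lowerbound[OF tendsto_inner[OF tendsto_const lim(1)]]) (use pos XC in \<open>auto intro!: less_imp_le always_eventually\<close>)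
  ultimately have "g \<bullet> u = 0" by simp
  then obtain s where s: "u = s *\<^sub>R a" using g l uv by auto
  have "f \<bullet> v \<le> norm g * 0"
    by (rule tendsto_le[OF _ z tendsto_inner[OF tendsto_const lim(2)]]) (use gY in auto)
  moreover have "f \<bullet> v \<ge> 0"
    by (rule tendsto_lowerbound[OF tendsto_inner[OF tendsto_const lim(2)]]) (use pos XC in \<open>auto intro!: less_imp_le always_eventually\<close>)
  ultimately have "f \<bullet> v = 0" by simp
  then obtain t where t: "v = t *\<^sub>R b" using f l uv by auto
  have "s \<noteq> 0" "t \<noteq> 0" using l uv s t by auto
  then have st: "s > 0" "t > 0"
    using positive_on_axis_ray proper_cone_axis.positive_on_axis_ray[OF swap] l uv s t by auto
  obtain e where e: "e > 0" "\<And>w. norm (w - (u + v)) < e \<Longrightarrow> near 1 w (u + v)"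
    using near_open[OF C_axis[OF st]] s t by auto
  have "(\<lambda>n. X (r n) + Y (r n)) \<longlonglongrightarrow> u + v" using lim by (intro tendsto_intros)
  then obtain n where "norm (X (r n) + Y (r n) - (u + v)) < e"
    using e(1) LIMSEQ_D by blast
  then have "near 1 (inverse (norm (x (r n))) *\<^sub>R x (r n) + inverse (norm (y (r n))) *\<^sub>R y (r n)) (s *\<^sub>R a + t *\<^sub>R b)"
    using e(2) by (simp add: X_def Y_def s t)
  moreover have "inverse (norm (x (r n))) > 0" "inverse (norm (y (r n))) > 0" using nz by auto
  ultimately have "segment_near_axis (x (r n)) (y (r n))"
    unfolding segment_near_axis_def using st by blast
  then show False using xy by blast
qed

text \<open>Each application of \<open>h\<close> raises \<pi> by the constant
  \<open>\<rho> / 2\<close>. A segment with a large change of \<pi> can therefore be shifted until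
  its ends satisfy the ratio conditions of \<open>segment_near_axis_of_ends\<close>, and being near
  the axis is invariant under the shift.\<close>

lemma axis_contracting:
  "\<exists>\<pi> B. (\<forall>x\<in>C. \<forall>y\<in>C. \<forall>r. near r x y \<longrightarrow> \<bar>\<pi> x - \<pi> y\<bar> \<le> r)
    \<and> (\<forall>s>0. \<forall>t>0. \<forall>s'>0. \<forall>t'>0. near \<bar>\<pi> (s *\<^sub>R a + t *\<^sub>R b) - \<pi> (s' *\<^sub>R a + t' *\<^sub>R b)\<bar>
          (s *\<^sub>R a + t *\<^sub>R b) (s' *\<^sub>R a + t' *\<^sub>R b))
    \<and> (\<forall>x\<in>C. \<forall>y\<in>C. \<bar>\<pi> x - \<pi> y\<bar> > B \<longrightarrow> segment_near_axis x y)"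
proof (rule invariant_functional_pair)
  fix f g
  assume f: "\<And>z. z \<in> K \<Longrightarrow> f \<bullet> z \<ge> 0" "f \<bullet> a = 1" "f \<bullet> b = 0" "\<And>z. f \<bullet> h z = lam * (f \<bullet> z)"
    "\<And>z. z \<in> K \<Longrightarrow> f \<bullet> z = 0 \<Longrightarrow> \<exists>t. z = t *\<^sub>R b"
    and g: "\<And>z. z \<in> K \<Longrightarrow> g \<bullet> z \<ge> 0" "g \<bullet> a = 0" "g \<bullet> b = 1" "\<And>z. g \<bullet> h z = mu * (g \<bullet> z)"
    "\<And>z. z \<in> K \<Longrightarrow> g \<bullet> z = 0 \<Longrightarrow> \<exists>t. z = t *\<^sub>R a"
    and pos: "\<And>z. z \<in> C \<Longrightarrow> f \<bullet> z > 0" "\<And>z. z \<in> C \<Longrightarrow> g \<bullet> z > 0"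
  obtain B where B: "B > 0" "\<And>x y. x \<in> C \<Longrightarrow> y \<in> C \<Longrightarrow> f \<bullet> x \<ge> B * (g \<bullet> x) \<Longrightarrow> g \<bullet> y \<ge> B * (f \<bullet> y) \<Longrightarrow> segment_near_axis x y"
    using segment_near_axis_of_ends[OF g(5) f(5) pos] by blast
  define \<rho> where "\<rho> = ln lam - ln mu"
  have lpos: "lam > 0" using eig by simp
  have \<rho>: "\<rho> > 0" using eig by (simp add: \<rho>_def)
  define \<pi> where "\<pi> x = (1/2) * ln ((f \<bullet> x) / (g \<bullet> x))" for x
  have \<pi>_hn: "\<pi> ((h ^^ n) x) = \<pi> x + n * \<rho> / 2" if "x \<in> C" for x n
  proof -
    have "f \<bullet> (h ^^ n) x = lam ^ n * (f \<bullet> x)" "g \<bullet> (h ^^ n) x = mu ^ n * (g \<bullet> x)"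
      by (induction n) (auto simp: f g)
    then show ?thesis using pos[OF that] eig lpos
      by (simp add: \<pi>_def \<rho>_def ln_mult ln_div ln_realpow field_simps)
  qed
  have far: "segment_near_axis x y" if x: "x \<in> C" and y: "y \<in> C" and le: "\<pi> x \<ge> ln B / 2" "\<pi> y \<le> - ln B / 2" for x y
  proof (rule B(2)[OF x y])
    have p: "f \<bullet> x > 0" "g \<bullet> x > 0" "f \<bullet> y > 0" "g \<bullet> y > 0" using pos x y by auto
    have "ln (B * (g \<bullet> x)) \<le> ln (f \<bullet> x)" using le(1) p B(1) by (simp add: \<pi>_def ln_mult ln_div)
    then show "f \<bullet> x \<ge> B * (g \<bullet> x)" using p B(1) by simp
    have "ln (B * (f \<bullet> y)) \<le> ln (g \<bullet> y)" using le(2) p B(1) by (simp add: \<pi>_def ln_mult ln_div)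
    then show "g \<bullet> y \<ge> B * (f \<bullet> y)" using p B(1) by simp
  qed
  have contr: "segment_near_axis x y" if x: "x \<in> C" and y: "y \<in> C" and le: "\<pi> x - \<pi> y > \<bar>ln B\<bar> + \<rho> / 2" for x y
  proof -
    interpret s: proper_cone_axis C w h' h b a "1 / mu" "1 / lam" by (rule swap)
    \<comment> \<open>Undoing \<open>k\<close> shifts places \<pi> of the first end between
      \<open>ln B / 2\<close> and \<open>ln B / 2 + \<rho> / 2\<close>. The assumed difference then
      puts \<pi> of the other end below \<open>ln B / 2 - \<bar>ln B\<bar>\<close>, which is at most
      \<open>- ln B / 2\<close>. For negative \<open>k\<close> the shifts are by \<open>h\<close>
      instead of \<open>h'\<close>.\<close>
    define k where "k = \<lfloor>(\<pi> x - ln B / 2) / (\<rho> / 2)\<rfloor>"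
    have "of_int k \<le> (\<pi> x - ln B / 2) / (\<rho> / 2)" "(\<pi> x - ln B / 2) / (\<rho> / 2) < of_int k + 1"
      unfolding k_def by linarith+
    then have k: "of_int k * (\<rho> / 2) \<le> \<pi> x - ln B / 2" "\<pi> x - ln B / 2 < of_int k * (\<rho> / 2) + \<rho> / 2"
      using \<rho> by (simp_all add: field_simps)
    show ?thesis
    proof (cases "k \<ge> 0")
      case True
      define n where "n = nat k"
      have n: "real_of_int k = real n" using True by (simp add: n_def)
      define x' y' where "x' = (h' ^^ n) x" and "y' = (h' ^^ n) y"
      have C: "x' \<in> C" "y' \<in> C" using x y s.hn_C by (auto simp: x'_def y'_def)
      have e: "(h ^^ n) x' = x" "(h ^^ n) y' = y" by (simp_all add: x'_def y'_def hn_inv)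
      have "\<pi> x = \<pi> x' + n * \<rho> / 2" "\<pi> y = \<pi> y' + n * \<rho> / 2"
        using \<pi>_hn[OF C(1), of n] \<pi>_hn[OF C(2), of n] by (simp_all add: e)
      moreover have "real n * \<rho> / 2 \<le> \<pi> x - ln B / 2" "\<pi> x - ln B / 2 < real n * \<rho> / 2 + \<rho> / 2"
        using k unfolding n by simp_all
      ultimately have "\<pi> x' \<ge> ln B / 2" "\<pi> y' \<le> - ln B / 2" using le by linarith+
      then have "segment_near_axis x' y'" by (rule far[OF C])
      then show ?thesis using segment_near_axis_hn[of n x' y'] e by simp
    next
      case False
      define n where "n = nat (- k)"
      have n: "real_of_int k = - real n" using False by (simp add: n_def)
      have "- (real n * \<rho> / 2) \<le> \<pi> x - ln B / 2" "\<pi> x - ln B / 2 < - (real n * \<rho> / 2) + \<rho> / 2"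
        using k unfolding n by simp_all
      then have "\<pi> ((h ^^ n) x) \<ge> ln B / 2" "\<pi> ((h ^^ n) y) \<le> - ln B / 2"
        using le \<pi>_hn[OF x, of n] \<pi>_hn[OF y, of n] by linarith+
      then have "segment_near_axis ((h ^^ n) x) ((h ^^ n) y)" by (intro far) (use x y hn_C in auto)
      then show ?thesis using segment_near_axis_hn by blast
    qed
  qed
  have contr2: "segment_near_axis x y" if "x \<in> C" "y \<in> C" "\<bar>\<pi> x - \<pi> y\<bar> > \<bar>ln B\<bar> + \<rho> / 2" for x y
    using contr[of x y] contr[of y x] segment_near_axis_sym that by (cases "\<pi> x \<ge> \<pi> y") auto
  have lip: "\<bar>\<pi> x - \<pi> y\<bar> \<le> r" if "x \<in> C" "y \<in> C" "near r x y" for x y r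
    using near_functional[OF that(3,1) f(1) pos(1) g(1) pos(2) that(2)]
      near_functional[OF near_sym[OF that(1,3)] that(2) f(1) pos(1) g(1) pos(2) that(1)]
    by (simp add: \<pi>_def abs_le_iff)
  have \<pi>_axis: "\<pi> (s *\<^sub>R a + t *\<^sub>R b) = ln (s / t) / 2" for s t
    using f g by (simp add: \<pi>_def inner_add_right)
  have axis: "near \<bar>\<pi> (s *\<^sub>R a + t *\<^sub>R b) - \<pi> (s' *\<^sub>R a + t' *\<^sub>R b)\<bar> (s *\<^sub>R a + t *\<^sub>R b) (s' *\<^sub>R a + t' *\<^sub>R b)"
    if st: "s > 0" "t > 0" "s' > 0" "t' > 0" for s t s' t'
  proof -
    \<comment> \<open>Combinations of \<open>a\<close> and \<open>b\<close> with nonnegative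
      coefficients lie in \<open>K\<close>, so the extreme coefficient ratios are valid bounds.
      Their quotient is exactly \<open>exp (2 * D)\<close>.\<close>
    define \<alpha> where "\<alpha> = min (s' / s) (t' / t)"
    define \<beta> where "\<beta> = max (s' / s) (t' / t)"
    define D where "D = \<bar>\<pi> (s *\<^sub>R a + t *\<^sub>R b) - \<pi> (s' *\<^sub>R a + t' *\<^sub>R b)\<bar>"
    have "\<alpha> > 0" using st by (simp add: \<alpha>_def)
    have "(s' - \<alpha> * s) *\<^sub>R a + (t' - \<alpha> * t) *\<^sub>R b \<in> K" "(\<beta> * s - s') *\<^sub>R a + (\<beta> * t - t') *\<^sub>R b \<in> K"
      using st ab by (intro K_add K_scale; simp add: \<alpha>_def \<beta>_def min_def max_def field_simps)+
    then have 1: "(s' *\<^sub>R a + t' *\<^sub>R b) - \<alpha> *\<^sub>R (s *\<^sub>R a + t *\<^sub>R b) \<in> K" "\<beta> *\<^sub>R (s *\<^sub>R a + t *\<^sub>R b) - (s' *\<^sub>R a + t' *\<^sub>R b) \<in> K"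
      by (simp_all add: algebra_simps)
    have D2: "2 * D = \<bar>ln (s' / s) - ln (t' / t)\<bar>"
      using st by (simp add: D_def \<pi>_axis ln_div) argo
    have "2 * D = ln (\<beta> / \<alpha>)"
    proof (cases "s' / s \<le> t' / t")
      case True
      then have "ln (s' / s) \<le> ln (t' / t)" using st by (intro ln_mono) auto
      then have "2 * D = ln ((t' / t) / (s' / s))" unfolding D2 using st by (subst ln_divide_pos) auto
      moreover have "\<alpha> = s' / s" "\<beta> = t' / t" using True by (auto simp: \<alpha>_def \<beta>_def)
      ultimately show ?thesis by metis
    next
      case False
      then have "ln (t' / t) \<le> ln (s' / s)" using st by (intro ln_mono) auto
      then have "2 * D = ln ((s' / s) / (t' / t))" unfolding D2 using st by (subst ln_divide_pos) auto
      moreover have "\<alpha> = t' / t" "\<beta> = s' / s" using False by (auto simp: \<alpha>_def \<beta>_def)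
      ultimately show ?thesis by metis
    qed
    moreover have "\<beta> > 0" using st by (simp add: \<beta>_def max_def)
    ultimately have "\<beta> = exp (2 * D) * \<alpha>" using \<open>\<alpha> > 0\<close> by simp
    then show ?thesis unfolding near_def D_def[symmetric] using 1 \<open>\<alpha> > 0\<close>
      by (intro exI[of _ \<alpha>] conjI exI[of _ \<beta>]) auto
  qed
  show ?thesis
    by (rule exI[of _ \<pi>], rule exI[of _ "\<bar>ln B\<bar> + \<rho> / 2"])
      (intro conjI ballI allI impI lip axis; (assumption | simp add: contr2))
qed

end

section \<open>Convex domains and their cones\<close>

definition pt :: "real ^ 'n \<Rightarrow> ('n::finite) proj" where
  "pt v = Abs_proj (span {v})"

lemma line_of_pt: "v \<noteq> 0 \<Longrightarrow> line_of (pt v) = span {v}"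
  unfolding pt_def by (intro Abs_proj_inverse) (simp add: dim_singleton)

lemma pt_unique:
  assumes "v \<in> line_of p" "v \<noteq> 0" shows "p = pt v"
proof -
  have p: "subspace (line_of p)" "dim (line_of p) = 1" using line_of[of p] by auto
  have "span {v} \<subseteq> line_of p" using p assms by (simp add: span_minimal)
  moreover have "dim (span {v}) = 1" using assms by (simp add: dim_singleton)
  ultimately have "span {v} = line_of p" using p by (metis subspace_dim_equal subspace_span order_refl)
  then show ?thesis using line_of_pt[OF assms(2)] by (metis line_of_inject)
qed

lemma in_line_of_pt: "v \<noteq> 0 \<Longrightarrow> u \<in> line_of (pt v) \<longleftrightarrow> (\<exists>c. u = c *\<^sub>R v)"
  by (auto simp: line_of_pt span_singleton)

lemma pt_scale: "c \<noteq> 0 \<Longrightarrow> v \<noteq> 0 \<Longrightarrow> pt (c *\<^sub>R v) = pt v"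
  by (metis in_line_of_pt pt_unique scaleR_eq_0_iff)

lemma pt_eqD: "pt u = pt v \<Longrightarrow> u \<noteq> 0 \<Longrightarrow> v \<noteq> 0 \<Longrightarrow> \<exists>c. c \<noteq> 0 \<and> u = c *\<^sub>R v"
  using in_line_of_pt[of v u] in_line_of_pt[of u u] by (metis scaleR_one scaleR_zero_left)

lemma pt_surj: "\<exists>v. v \<noteq> 0 \<and> p = pt v"
proof -
  have "dim (line_of p) = 1" using line_of[of p] by auto
  then have "\<not> line_of p \<subseteq> {0}" by (metis dim_eq_0 zero_neq_one)
  then show ?thesis using pt_unique by blast
qed

lemma open_proj_iff: "open U \<longleftrightarrow> open {v. v \<noteq> 0 \<and> pt v \<in> U}"
proof -
  have "(\<Union>p\<in>U. line_of p) - {0} = {v. v \<noteq> 0 \<and> pt v \<in> U}"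
    using pt_unique in_line_of_pt by (auto, metis scaleR_one)
  then show ?thesis by (simp add: open_proj_def)
qed

lemma pt_in_chart_domain: "v \<noteq> 0 \<Longrightarrow> pt v \<in> chart_domain w \<longleftrightarrow> w \<bullet> v \<noteq> 0"
  by (auto simp: chart_domain_def line_of_pt span_singleton subset_iff)

lemma chart_pt:
  assumes "w \<bullet> v \<noteq> 0" shows "chart w (pt v) = inverse (w \<bullet> v) *\<^sub>R v"
proof -
  have v: "v \<noteq> 0" using assms by auto
  show ?thesis unfolding chart_def
  proof (rule the_equality)
    show "inverse (w \<bullet> v) *\<^sub>R v \<in> line_of (pt v) \<and> w \<bullet> inverse (w \<bullet> v) *\<^sub>R v = 1"
      using assms v in_line_of_pt by auto
  next
    fix u assume "u \<in> line_of (pt v) \<and> w \<bullet> u = 1"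
    then obtain c where c: "u = c *\<^sub>R v" "w \<bullet> u = 1" using in_line_of_pt[OF v] by blast
    then have "c = inverse (w \<bullet> v)" using assms by (simp add: field_simps)
    then show "u = inverse (w \<bullet> v) *\<^sub>R v" using c by simp
  qed
qed

lemma
  assumes "p \<in> chart_domain w"
  shows inner_chart: "w \<bullet> chart w p = 1" and pt_chart: "pt (chart w p) = p"
proof -
  obtain v where v: "v \<noteq> 0" "p = pt v" using pt_surj by blast
  then have wv: "w \<bullet> v \<noteq> 0" using assms pt_in_chart_domain by blast
  then show "w \<bullet> chart w p = 1" "pt (chart w p) = p" using v by (simp_all add: chart_pt pt_scale)
qed

section \<open>The cone over a convex domain\<close>

text \<open>Only the half of each line on which \<open>w\<close> is positive is kept; both halves
  together would not be convex.\<close>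

definition cone :: "real ^ 'n \<Rightarrow> ('n::finite) proj set \<Rightarrow> (real ^ 'n) set" where
  "cone w \<Omega> = {v. w \<bullet> v > 0 \<and> pt v \<in> \<Omega>}"

locale convex_domain =
  fixes \<Omega> :: "('n::finite) proj set" and w :: "real ^ 'n"
  assumes cic: "convex_in_chart w \<Omega>" and open_\<Omega>: "open \<Omega>" and \<Omega>_nonempty: "\<Omega> \<noteq> {}"
begin

abbreviation C :: "(real ^ 'n) set" where "C \<equiv> cone w \<Omega>"

lemma closure_chart_domain: "closure \<Omega> \<subseteq> chart_domain w"
  using cic by (simp add: convex_in_chart_def)

lemma \<Omega>_chart_domain: "p \<in> \<Omega> \<Longrightarrow> p \<in> chart_domain w"
  using closure_chart_domain closure_subset by blast

lemma in_C_iff: "v \<in> C \<longleftrightarrow> w \<bullet> v > 0 \<and> inverse (w \<bullet> v) *\<^sub>R v \<in> chart w ` \<Omega>"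
proof
  assume "v \<in> C"
  then show "w \<bullet> v > 0 \<and> inverse (w \<bullet> v) *\<^sub>R v \<in> chart w ` \<Omega>"
    unfolding cone_def by (auto simp: chart_pt[symmetric])
next
  assume v: "w \<bullet> v > 0 \<and> inverse (w \<bullet> v) *\<^sub>R v \<in> chart w ` \<Omega>"
  then obtain p where p: "p \<in> \<Omega>" "inverse (w \<bullet> v) *\<^sub>R v = chart w p" by auto
  have "v \<noteq> 0" using v by auto
  then have "pt v = p" using pt_chart[OF \<Omega>_chart_domain[OF p(1)]] p(2) v pt_scale[of "inverse (w \<bullet> v)" v] by auto
  then show "v \<in> C" using p v by (simp add: cone_def)
qed

lemma chart_in_C: "p \<in> \<Omega> \<Longrightarrow> chart w p \<in> C"
  using inner_chart[OF \<Omega>_chart_domain] pt_chart[OF \<Omega>_chart_domain] by (simp add: cone_def)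

sublocale proper_cone C w
proof
  have "C = {v. v \<noteq> 0 \<and> pt v \<in> \<Omega>} \<inter> {v. w \<bullet> v > 0}" by (auto simp: cone_def)
  moreover have "open {v. v \<noteq> 0 \<and> pt v \<in> \<Omega>}" using open_\<Omega> open_proj_iff[of \<Omega>] by simp
  ultimately show "open C" using open_halfspace_gt[of 0 w] by (simp add: open_Int)
  show "c *\<^sub>R x \<in> C" if "c > 0" "x \<in> C" for c x
    using that pt_scale[of c x] by (cases "x = 0") (auto simp: cone_def)
  show "0 \<notin> C" by (simp add: cone_def)
  show "C \<noteq> {}" using \<Omega>_nonempty chart_in_C by blast
  show "x + y \<in> C" if xy: "x \<in> C" "y \<in> C" for x y
  proof -
    define s where "s = w \<bullet> x"
    define t where "t = w \<bullet> y"
    have st: "s > 0" "t > 0" using xy by (auto simp: in_C_iff s_def t_def)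
    \<comment> \<open>The slice point of \<open>x + y\<close> is the average of the slice points of
      \<open>x\<close> and \<open>y\<close>, weighted by \<open>w \<bullet> x\<close> and
      \<open>w \<bullet> y\<close>.\<close>
    have "(s / (s + t)) *\<^sub>R (inverse s *\<^sub>R x) + (t / (s + t)) *\<^sub>R (inverse t *\<^sub>R y) \<in> chart w ` \<Omega>"
      using cic xy st by (intro convexD)
        (auto simp: convex_in_chart_def in_C_iff s_def t_def add_divide_distrib[symmetric])
    moreover have "(s / (s + t)) *\<^sub>R (inverse s *\<^sub>R x) + (t / (s + t)) *\<^sub>R (inverse t *\<^sub>R y) = inverse (s + t) *\<^sub>R (x + y)"
      using st by (simp add: scaleR_add_right inverse_eq_divide)
    ultimately show ?thesis using st by (simp add: in_C_iff s_def t_def inner_add_right)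
  qed
  obtain M where M: "M > 0" "\<And>u. u \<in> chart w ` \<Omega> \<Longrightarrow> norm u \<le> M"
    using cic unfolding convex_in_chart_def by (meson bounded_pos)
  have "norm v \<le> M * (w \<bullet> v)" if "v \<in> C" for v
    using that M(2)[of "inverse (w \<bullet> v) *\<^sub>R v"] by (auto simp: in_C_iff field_simps)
  then show "\<exists>M>0. \<forall>v\<in>C. norm v \<le> M * (w \<bullet> v)" using M(1) by blast
qed

lemma K_inner_pos: "v \<in> K \<Longrightarrow> v \<noteq> 0 \<Longrightarrow> w \<bullet> v > 0"
  using K_pointed by (metis norm_le_zero_iff not_less mult_nonneg_nonpos order_less_imp_le order_trans)

text \<open>Both directions carry neighbourhoods between the quotient topology and the vector space.
  The nonzero multiples of \<open>W\<close> form the saturated open set that the quotient topology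
  asks for; positivity of \<open>w\<close> on \<open>W\<close> keeps its points off the opposite
  cone.\<close>

lemma pt_in_closure:
  assumes "w \<bullet> v > 0" shows "pt v \<in> closure \<Omega> \<longleftrightarrow> v \<in> K"
proof
  have v: "v \<noteq> 0" using assms by auto
  {
    assume cl: "pt v \<in> closure \<Omega>"
    show "v \<in> K"
    proof (rule ccontr)
      assume n: "v \<notin> K"
      define W where "W = - K \<inter> {v. w \<bullet> v > 0}"
      define U where "U = pt ` W"
      have W: "open W" "v \<in> W" unfolding W_def using n assms by (auto intro: open_halfspace_gt)
      have W0: "x \<noteq> 0" if "x \<in> W" for x using that by (auto simp: W_def)
      have "{x. x \<noteq> 0 \<and> pt x \<in> U} = (\<Union>c\<in>-{0}. (*\<^sub>R) c ` W)"
      proof (intro equalityI subsetI)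
        fix x assume "x \<in> {x. x \<noteq> 0 \<and> pt x \<in> U}"
        then obtain y where y: "y \<in> W" "x \<noteq> 0" "pt x = pt y" by (auto simp: U_def)
        then obtain c where "c \<noteq> 0" "x = c *\<^sub>R y" using pt_eqD W0 by blast
        then show "x \<in> (\<Union>c\<in>-{0}. (*\<^sub>R) c ` W)" using y by auto
      next
        fix x assume "x \<in> (\<Union>c\<in>-{0}. (*\<^sub>R) c ` W)"
        then obtain c y where "c \<noteq> 0" "y \<in> W" "x = c *\<^sub>R y" by auto
        then show "x \<in> {x. x \<noteq> 0 \<and> pt x \<in> U}" using W0 by (auto simp: U_def pt_scale)
      qed
      moreover have "open (\<Union>c\<in>-{0}. (*\<^sub>R) c ` W)" using W by (intro open_UN ballI open_scaling) auto
      ultimately have "open U" by (simp add: open_proj_iff)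
      moreover have "pt v \<in> U" using W by (simp add: U_def)
      ultimately obtain q where q: "q \<in> U" "q \<in> \<Omega>" using cl by (meson closure_iff_nhds_not_empty disjoint_iff order_refl)
      then obtain x where "x \<in> W" "q = pt x" by (auto simp: U_def)
      then have "x \<in> C" using q by (simp add: cone_def W_def)
      then show False using \<open>x \<in> W\<close> C_K by (auto simp: W_def)
    qed
  }
  {
    assume vK: "v \<in> K"
    show "pt v \<in> closure \<Omega>"
    proof (rule ccontr)
      assume n: "pt v \<notin> closure \<Omega>"
      have "open {x. x \<noteq> 0 \<and> pt x \<in> - closure \<Omega>}" using open_proj_iff[of "- closure \<Omega>"] by (simp only: open_Compl closed_closure)
      then obtain e where e: "e > 0" "ball v e \<subseteq> {x. x \<noteq> 0 \<and> pt x \<in> - closure \<Omega>}"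
        using n v open_contains_ball by blast
      obtain x where "x \<in> C" "dist x v < e" using vK e closure_approachable by blast
      then have "x \<in> ball v e" "pt x \<in> \<Omega>" by (auto simp: dist_commute cone_def)
      then show False using e(2) closure_subset[of \<Omega>] by auto
    qed
  }
qed

lemma pt_K: "v \<in> K \<Longrightarrow> v \<noteq> 0 \<Longrightarrow> pt v \<in> closure \<Omega>"
  using pt_in_closure K_inner_pos by blast

lemma pt_C: "v \<in> C \<Longrightarrow> pt v \<in> \<Omega>"
  by (simp add: cone_def)

lemma chart_in_K: "p \<in> closure \<Omega> \<Longrightarrow> chart w p \<in> K"
  using pt_in_closure[of "chart w p"] inner_chart pt_chart closure_chart_domain by (metis subsetD zero_less_one)

lemma chart_closure:
  assumes "p \<in> closure \<Omega>" shows "w \<bullet> chart w p = 1" "pt (chart w p) = p" "chart w p \<noteq> 0"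
  using assms inner_chart pt_chart closure_chart_domain by fastforce+

lemma in_\<Omega>_iff_chart: "p \<in> closure \<Omega> \<Longrightarrow> p \<in> \<Omega> \<longleftrightarrow> chart w p \<in> C"
  using chart_in_C pt_C chart_closure(2) by metis

lemma in_frontier_iff: "p \<in> frontier \<Omega> \<longleftrightarrow> p \<in> closure \<Omega> \<and> chart w p \<notin> C"
  unfolding frontier_def interior_open[OF open_\<Omega>] using in_\<Omega>_iff_chart by blast

end

lemma closed_segment_on_line:
  fixes x d :: "'a::real_vector"
  assumes "s \<le> t"
  shows "closed_segment (x + s *\<^sub>R d) (x + t *\<^sub>R d) = (\<lambda>r. x + r *\<^sub>R d) ` {s..t}"
proof -
  have "closed_segment (s *\<^sub>R d) (t *\<^sub>R d) = (\<lambda>r. r *\<^sub>R d) ` closed_segment s t"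
    by (rule closed_segment_linear_image[of "\<lambda>r. r *\<^sub>R d"]) (simp add: linear_iff scaleR_left_distrib)
  then show ?thesis
    using assms by (simp add: closed_segment_translation closed_segment_eq_real_ivl image_image)
qed

section \<open>The Hilbert distance expressed by the cone order\<close>

context proper_cone
begin

text \<open>The chord ends lie \<open>p\<close> units before \<open>x\<close> and \<open>q\<close>
  units beyond \<open>y\<close>, measured in steps of \<open>y - x\<close>. Being on the boundary,
  they give the optimal constants: the least upper bound factor is \<open>(1 + p) / p\<close>, the
  largest lower one \<open>q / (1 + q)\<close>, and their quotient is the cross ratio.\<close>

lemma near_iff_cross_ratio:
  assumes x: "x \<in> C" and y: "y \<in> C" and p: "p > 0" and q: "q > 0"
    and a: "(1 + p) *\<^sub>R x - p *\<^sub>R y \<in> K" "(1 + p) *\<^sub>R x - p *\<^sub>R y \<notin> C"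
    and b: "(1 + q) *\<^sub>R y - q *\<^sub>R x \<in> K" "(1 + q) *\<^sub>R y - q *\<^sub>R x \<notin> C"
  shows "near r x y \<longleftrightarrow> 1 / 2 * ln (((1 + q) * (1 + p)) / (q * p)) \<le> r"
proof -
  have "near r x y \<longleftrightarrow> (1 + p) / p \<le> exp (2 * r) * (q / (1 + q))"
  proof
    assume "near r x y"
    then obtain \<alpha> \<beta> where 1: "\<alpha> > 0" "y - \<alpha> *\<^sub>R x \<in> K" "\<beta> *\<^sub>R x - y \<in> K" "\<beta> \<le> exp (2 * r) * \<alpha>"
      unfolding near_def by blast
    have "\<alpha> \<le> q / (1 + q)"
    proof (rule ccontr)
      assume n: "\<not> \<alpha> \<le> q / (1 + q)"
      then have "(1 + q) *\<^sub>R ((y - \<alpha> *\<^sub>R x) + (\<alpha> - q / (1 + q)) *\<^sub>R x) \<in> C"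
        using 1(2) x q by (intro C_scale K_C_add) auto
      moreover have "(1 + q) *\<^sub>R ((y - \<alpha> *\<^sub>R x) + (\<alpha> - q / (1 + q)) *\<^sub>R x) = (1 + q) *\<^sub>R y - q *\<^sub>R x"
        using q by (simp add: scaleR_diff_left scaleR_diff_right)
      ultimately show False using b(2) by metis
    qed
    moreover have "(1 + p) / p \<le> \<beta>"
    proof (rule ccontr)
      assume n: "\<not> (1 + p) / p \<le> \<beta>"
      then have "p *\<^sub>R ((\<beta> *\<^sub>R x - y) + ((1 + p) / p - \<beta>) *\<^sub>R x) \<in> C"
        using 1(3) x p by (intro C_scale K_C_add) auto
      moreover have "p *\<^sub>R ((\<beta> *\<^sub>R x - y) + ((1 + p) / p - \<beta>) *\<^sub>R x) = (1 + p) *\<^sub>R x - p *\<^sub>R y"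
        using p by (simp add: scaleR_diff_left scaleR_diff_right)
      ultimately show False using a(2) by metis
    qed
    moreover have "exp (2 * r) * \<alpha> \<le> exp (2 * r) * (q / (1 + q))" using calculation(1) by (intro mult_left_mono) auto
    ultimately show "(1 + p) / p \<le> exp (2 * r) * (q / (1 + q))" using 1(4) by linarith
  next
    assume le: "(1 + p) / p \<le> exp (2 * r) * (q / (1 + q))"
    have "inverse (1 + q) *\<^sub>R ((1 + q) *\<^sub>R y - q *\<^sub>R x) \<in> K" "inverse p *\<^sub>R ((1 + p) *\<^sub>R x - p *\<^sub>R y) \<in> K"
      using a b p q by (intro K_scale; simp)+
    moreover have "inverse (1 + q) *\<^sub>R ((1 + q) *\<^sub>R y - q *\<^sub>R x) = y - (q / (1 + q)) *\<^sub>R x"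
      using q by (simp add: scaleR_diff_right divide_inverse mult.commute)
    moreover have "inverse p *\<^sub>R ((1 + p) *\<^sub>R x - p *\<^sub>R y) = ((1 + p) / p) *\<^sub>R x - y"
      using p by (simp add: scaleR_diff_right divide_inverse mult.commute)
    moreover have "q / (1 + q) > 0" using q by simp
    ultimately show "near r x y" unfolding near_def using le by metis
  qed
  also have "\<dots> \<longleftrightarrow> ((1 + q) * (1 + p)) / (q * p) \<le> exp (2 * r)"
    using p q by (simp add: field_simps)
  also have "\<dots> \<longleftrightarrow> ln (((1 + q) * (1 + p)) / (q * p)) \<le> 2 * r"
    using p q by (subst ln_le_cancel_iff[symmetric]) (auto intro!: divide_pos_pos mult_pos_pos)
  finally show ?thesis by (simp add: mult.commute)
qed

end

text \<open>Segments and distances are defined in a chart picked by \<open>SOME\<close>. Taking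
  \<open>w\<close> to be that choice lets them be read off in the cone \<open>C\<close>.\<close>

locale charted_convex_domain = convex_domain +
  assumes chart_of: "chart_of \<Omega> = chart w"
begin

lemma in_segment_iff: "p \<in> segment \<Omega> x y \<longleftrightarrow> p \<in> closure \<Omega> \<and> chart w p \<in> closed_segment (chart w x) (chart w y)"
  by (simp add: segment_def chart_of)

lemma chart_eq: "p \<in> closure \<Omega> \<Longrightarrow> q \<in> closure \<Omega> \<Longrightarrow> chart w p = chart w q \<longleftrightarrow> p = q"
  using chart_closure(2) by metis

text \<open>The left-hand side does not mention \<open>a\<close> and \<open>b\<close>, so this also gives the
  uniqueness that the definite description in \<open>hilbert_dist\<close> needs.\<close>

lemma chord_value:
  assumes x: "x \<in> \<Omega>" and y: "y \<in> \<Omega>" and xy: "x \<noteq> y" and ch: "chord_ends \<Omega> x y a b"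
  shows "near r (chart w x) (chart w y) \<longleftrightarrow>
    1 / 2 * ln (dist (chart_of \<Omega> b) (chart_of \<Omega> x) * dist (chart_of \<Omega> y) (chart_of \<Omega> a) /
           (dist (chart_of \<Omega> b) (chart_of \<Omega> y) * dist (chart_of \<Omega> x) (chart_of \<Omega> a))) \<le> r"
proof -
  define X where "X = chart w x"
  define Y where "Y = chart w y"
  define A where "A = chart w a"
  define B where "B = chart w b"
  have cl: "x \<in> closure \<Omega>" "y \<in> closure \<Omega>" using x y closure_subset by auto
  have XY: "X \<in> C" "Y \<in> C" using x y chart_in_C by (auto simp: X_def Y_def)
  have ne: "X \<noteq> Y" using xy cl chart_eq by (simp add: X_def Y_def)
  have AB: "A \<in> K" "A \<notin> C" "B \<in> K" "B \<notin> C"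
    using ch chart_in_K by (auto simp: chord_ends_def in_frontier_iff A_def B_def)
  have "X \<in> closed_segment A Y" "Y \<in> closed_segment X B"
    using ch by (auto simp: chord_ends_def in_segment_iff X_def Y_def A_def B_def)
  then obtain u v where u: "0 \<le> u" "u \<le> 1" "X = (1 - u) *\<^sub>R A + u *\<^sub>R Y"
    and v: "0 \<le> v" "v \<le> 1" "Y = (1 - v) *\<^sub>R X + v *\<^sub>R B" by (auto simp: in_segment)
  have "u \<noteq> 0" "u \<noteq> 1" "v \<noteq> 0" "v \<noteq> 1" using u(3) v(3) XY AB ne by auto
  then have uv: "u > 0" "u < 1" "v > 0" "v < 1" using u v by auto
  \<comment> \<open>These values yield \<open>X - A = p (Y - X)\<close> and
    \<open>B - Y = q (Y - X)\<close>.\<close>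
  define p where "p = u / (1 - u)"
  define q where "q = (1 - v) / v"
  have pq: "p > 0" "q > 0" using uv by (auto simp: p_def q_def)
  have p1: "1 + p = inverse (1 - u)" and p2: "p = inverse (1 - u) * u" and q1: "1 + q = inverse v" and q2: "q = inverse v * (1 - v)"
    using uv by (auto simp: p_def q_def field_simps)
  have "(1 + p) *\<^sub>R X - p *\<^sub>R Y = inverse (1 - u) *\<^sub>R (X - u *\<^sub>R Y)" unfolding p1 p2[symmetric]
    by (subst p2) (simp add: scaleR_diff_right)
  also have "X - u *\<^sub>R Y = (1 - u) *\<^sub>R A" using u(3) by (metis add_diff_cancel_right')
  finally have Aeq: "A = (1 + p) *\<^sub>R X - p *\<^sub>R Y" using uv by simp
  have "(1 + q) *\<^sub>R Y - q *\<^sub>R X = inverse v *\<^sub>R (Y - (1 - v) *\<^sub>R X)" unfolding q1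
    by (subst q2) (simp add: scaleR_diff_right)
  also have "Y - (1 - v) *\<^sub>R X = v *\<^sub>R B" using v(3) by (metis add_diff_cancel_left')
  finally have Beq: "B = (1 + q) *\<^sub>R Y - q *\<^sub>R X" using uv by simp
  define D where "D = norm (Y - X)"
  have D: "D > 0" using ne by (simp add: D_def)
  have "B - X = (1 + q) *\<^sub>R (Y - X)" "Y - A = (1 + p) *\<^sub>R (Y - X)" "B - Y = q *\<^sub>R (Y - X)" "X - A = p *\<^sub>R (Y - X)"
    by (simp_all add: Aeq Beq algebra_simps)
  then have "dist B X = (1 + q) * D" "dist Y A = (1 + p) * D" "dist B Y = q * D" "dist X A = p * D"
    using pq by (simp_all add: dist_norm D_def)
  then have "dist B X * dist Y A / (dist B Y * dist X A) = ((1 + q) * (1 + p)) / (q * p)"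
    using D by simp
  moreover have "near r X Y \<longleftrightarrow> 1 / 2 * ln (((1 + q) * (1 + p)) / (q * p)) \<le> r"
    using XY pq AB unfolding Aeq Beq by (intro near_iff_cross_ratio)
  ultimately show ?thesis unfolding chart_of X_def[symmetric] Y_def[symmetric] A_def[symmetric] B_def[symmetric]
    by (simp only:)
qed

lemma in_proj_line_iff:
  assumes "x \<in> closure \<Omega>" "y \<in> closure \<Omega>" "p \<in> closure \<Omega>"
  shows "p \<in> proj_line x y \<longleftrightarrow> (\<exists>t. chart w p = chart w x + t *\<^sub>R (chart w y - chart w x))"
proof -
  have line: "line_of q = span {chart w q}" if "q \<in> closure \<Omega>" for q
    using line_of_pt[OF chart_closure(3)[OF that]] chart_closure(2)[OF that] by simp
  have S: "subspace (span (line_of x \<union> line_of y))" by simp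
  have "p \<in> proj_line x y \<longleftrightarrow> span {chart w p} \<subseteq> span (line_of x \<union> line_of y)"
    by (simp add: proj_line_def proj_of_def line assms)
  also have "\<dots> \<longleftrightarrow> chart w p \<in> span (line_of x \<union> line_of y)"
    using span_minimal[OF _ S, of "{chart w p}"] span_base[of "chart w p" "{chart w p}"] by blast
  also have "\<dots> \<longleftrightarrow> (\<exists>s t. chart w p = s *\<^sub>R chart w x + t *\<^sub>R chart w y)"
    unfolding line[OF assms(1)] line[OF assms(2)] span_Un span_span by (auto simp: span_singleton)
  also have "\<dots> \<longleftrightarrow> (\<exists>t. chart w p = chart w x + t *\<^sub>R (chart w y - chart w x))"
  proof
    assume "\<exists>s t. chart w p = s *\<^sub>R chart w x + t *\<^sub>R chart w y"
    then obtain s t where st: "chart w p = s *\<^sub>R chart w x + t *\<^sub>R chart w y" by blast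
    then have "w \<bullet> chart w p = s * (w \<bullet> chart w x) + t * (w \<bullet> chart w y)" by (simp add: inner_add_right)
    \<comment> \<open>All three chart vectors satisfy \<open>w \<bullet> v = 1\<close>, which forces
      the coefficients to sum to 1.\<close>
    then have s: "s = 1 - t" using assms by (simp add: chart_closure)
    then show "\<exists>t. chart w p = chart w x + t *\<^sub>R (chart w y - chart w x)"
      unfolding st s by (intro exI[of _ t]) (simp add: scaleR_diff_left scaleR_diff_right)
  next
    assume "\<exists>t. chart w p = chart w x + t *\<^sub>R (chart w y - chart w x)"
    then obtain t where "chart w p = chart w x + t *\<^sub>R (chart w y - chart w x)" by blast
    then have "chart w p = (1 - t) *\<^sub>R chart w x + t *\<^sub>R chart w y" by (simp add: algebra_simps)
    then show "\<exists>s t. chart w p = s *\<^sub>R chart w x + t *\<^sub>R chart w y" by blast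
  qed
  finally show ?thesis .
qed

text \<open>The parameters at which the affine line through \<open>X\<close> and \<open>Y\<close>
  meets \<open>K\<close> form a compact interval by closedness, convexity and boundedness of the
  slice. Its ends give the chord ends.\<close>

lemma chord_ends_exist:
  assumes x: "x \<in> \<Omega>" and y: "y \<in> \<Omega>" and xy: "x \<noteq> y"
  shows "\<exists>a b. chord_ends \<Omega> x y a b"
proof -
  define X where "X = chart w x"
  define Y where "Y = chart w y"
  define D where "D = Y - X"
  have cl: "x \<in> closure \<Omega>" "y \<in> closure \<Omega>" using x y closure_subset by auto
  have XY: "X \<in> C" "Y \<in> C" using x y chart_in_C by (auto simp: X_def Y_def)
  have D: "D \<noteq> 0" using xy cl chart_eq by (simp add: X_def Y_def D_def)
  have wX: "w \<bullet> X = 1" "w \<bullet> Y = 1" using cl by (simp_all add: X_def Y_def chart_closure)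
  have wD: "w \<bullet> (X + t *\<^sub>R D) = 1" for t using wX by (simp add: D_def inner_add_right inner_diff_right)
  define T where "T = {t. X + t *\<^sub>R D \<in> K}"
  have "closed ((\<lambda>t. X + t *\<^sub>R D) -` K)" by (intro closed_vimage continuous_intros) auto
  then have clT: "closed T" by (simp add: T_def vimage_def)
  obtain M where M: "M > 0" "\<And>v. v \<in> K \<Longrightarrow> norm v \<le> M * (w \<bullet> v)" using K_pointed by blast
  have "\<bar>t\<bar> \<le> (M + norm X) / norm D" if "t \<in> T" for t
  proof -
    have "norm (X + t *\<^sub>R D) \<le> M" using M(2)[of "X + t *\<^sub>R D"] that wD by (simp add: T_def)
    then have "norm (t *\<^sub>R D) \<le> M + norm X" using norm_triangle_ineq4[of "X + t *\<^sub>R D" X] by simp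
    then show ?thesis using D by (simp add: field_simps)
  qed
  then have "bounded T" by (intro boundedI) auto
  then have bdd: "bdd_above T" "bdd_below T" using bounded_imp_bdd_above bounded_imp_bdd_below by auto
  have T01: "0 \<in> T" "1 \<in> T" using XY C_K by (auto simp: T_def D_def)
  define t0 where "t0 = Inf T"
  define t1 where "t1 = Sup T"
  have t0T: "t0 \<in> T" unfolding t0_def using T01 bdd clT by (intro closed_contains_Inf) auto
  have t1T: "t1 \<in> T" unfolding t1_def using T01 bdd clT by (intro closed_contains_Sup) auto
  have T_bd: "t0 \<le> t" "t \<le> t1" if "t \<in> T" for t
    using that bdd by (auto simp: t0_def t1_def intro: cInf_lower cSup_upper)
  have "convex K" using convex_C by (rule convex_closure)
  then have T_eq: "T = {t0..t1}"
  proof (intro equalityI subsetI)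
    fix t assume "t \<in> {t0..t1}"
    then have "X + t *\<^sub>R D \<in> closed_segment (X + t0 *\<^sub>R D) (X + t1 *\<^sub>R D)"
      by (subst closed_segment_on_line) auto
    then show "t \<in> T" using \<open>convex K\<close> t0T t1T closed_segment_subset[of "X + t0 *\<^sub>R D" K "X + t1 *\<^sub>R D"]
      by (auto simp: T_def)
  qed (use T_bd in auto)
  \<comment> \<open>A parameter whose point lies in the open cone can be moved both ways, so it
    cannot be an end of \<open>T\<close>.\<close>
  have interior: "\<exists>e>0. t - e \<in> T \<and> t + e \<in> T" if t: "X + t *\<^sub>R D \<in> C" for t
  proof -
    obtain e where e: "e > 0" "ball (X + t *\<^sub>R D) e \<subseteq> C" using openE[OF open_C t] by blast
    define d where "d = e / (2 * norm D)"
    have d: "d > 0" "norm (d *\<^sub>R D) < e" using e(1) D by (auto simp: d_def)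
    have "X + t *\<^sub>R D + d *\<^sub>R D \<in> C" "X + t *\<^sub>R D - d *\<^sub>R D \<in> C" using e(2) d by (auto simp: subset_iff dist_norm)
    then have "X + (t + d) *\<^sub>R D \<in> K" "X + (t - d) *\<^sub>R D \<in> K" using C_K by (auto simp: algebra_simps)
    then show ?thesis using d(1) by (auto simp: T_def)
  qed
  define A where "A = X + t0 *\<^sub>R D"
  define B where "B = X + t1 *\<^sub>R D"
  have AC: "A \<notin> C"
  proof
    assume "A \<in> C"
    then obtain e where "e > 0" "t0 - e \<in> T" using interior by (auto simp: A_def)
    then show False using T_bd(1)[of "t0 - e"] by simp
  qed
  have BC: "B \<notin> C"
  proof
    assume "B \<in> C"
    then obtain e where "e > 0" "t1 + e \<in> T" using interior by (auto simp: B_def)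
    then show False using T_bd(2)[of "t1 + e"] by simp
  qed
  have AK: "A \<in> K" "B \<in> K" using t0T t1T by (simp_all add: T_def A_def B_def)
  have ch: "chart w (pt A) = A" "chart w (pt B) = B" using wD by (simp_all add: chart_pt A_def B_def)
  have AB0: "A \<noteq> 0" "B \<noteq> 0" using wD[of t0] wD[of t1] by (auto simp: A_def B_def)
  have clAB: "pt A \<in> closure \<Omega>" "pt B \<in> closure \<Omega>" using pt_K AK AB0 by auto
  have fr: "pt A \<in> frontier \<Omega>" "pt B \<in> frontier \<Omega>" using clAB AC BC ch by (auto simp: in_frontier_iff)
  have X0: "X = X + 0 *\<^sub>R D" and Y1: "Y = X + 1 *\<^sub>R D" by (simp_all add: D_def)
  have le: "t0 \<le> 0" "1 \<le> t1" using T_bd T01 by auto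
  have "closure \<Omega> \<inter> proj_line x y = segment \<Omega> (pt A) (pt B)"
  proof (intro set_eqI)
    fix p
    have "p \<in> proj_line x y \<longleftrightarrow> chart w p \<in> closed_segment A B" if p: "p \<in> closure \<Omega>"
    proof -
      have "p \<in> proj_line x y \<longleftrightarrow> (\<exists>t. chart w p = X + t *\<^sub>R D)"
        unfolding in_proj_line_iff[OF cl p] X_def[symmetric] Y_def[symmetric] D_def[symmetric] ..
      also have "\<dots> \<longleftrightarrow> (\<exists>t\<in>T. chart w p = X + t *\<^sub>R D)"
        using chart_in_K[OF p] by (auto simp: T_def)
      also have "\<dots> \<longleftrightarrow> chart w p \<in> closed_segment A B"
        unfolding A_def B_def T_eq using le by (subst closed_segment_on_line) auto
      finally show ?thesis .
    qed
    then show "p \<in> closure \<Omega> \<inter> proj_line x y \<longleftrightarrow> p \<in> segment \<Omega> (pt A) (pt B)"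
      by (auto simp: in_segment_iff ch)
  qed
  moreover have "x \<in> segment \<Omega> (pt A) y"
  proof -
    have "X + 0 *\<^sub>R D \<in> closed_segment (X + t0 *\<^sub>R D) (X + 1 *\<^sub>R D)"
      using le by (subst closed_segment_on_line) (auto intro: image_eqI[where x = 0])
    then show ?thesis using cl unfolding X0[symmetric] Y1[symmetric] A_def[symmetric]
      by (simp add: in_segment_iff ch X_def Y_def)
  qed
  moreover have "y \<in> segment \<Omega> x (pt B)"
  proof -
    have "X + 1 *\<^sub>R D \<in> closed_segment (X + 0 *\<^sub>R D) (X + t1 *\<^sub>R D)"
      using le by (subst closed_segment_on_line) (auto intro: image_eqI[where x = 1])
    then show ?thesis using cl unfolding X0[symmetric] Y1[symmetric] B_def[symmetric]
      by (simp add: in_segment_iff ch X_def Y_def)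
  qed
  ultimately show ?thesis unfolding chord_ends_def using fr by blast
qed

text \<open>By \<open>chord_value\<close> the value on any chord is the least radius for which
  \<open>near\<close> holds, so all chords agree and the definite description is legitimate. The
  metric properties of \<open>near\<close> thereby become those of the Hilbert distance.\<close>

lemma hilbert_dist_le_iff:
  assumes x: "x \<in> \<Omega>" and y: "y \<in> \<Omega>"
  shows "hilbert_dist \<Omega> x y \<le> r \<longleftrightarrow> near r (chart w x) (chart w y)"
proof (cases "x = y")
  case True
  then show ?thesis
    using near_refl near_nonneg[OF chart_in_C[OF x]] by (auto simp: hilbert_dist_def)
next
  case False
  define V where "V a b = 1 / 2 * ln (dist (chart_of \<Omega> b) (chart_of \<Omega> x) * dist (chart_of \<Omega> y) (chart_of \<Omega> a) /
           (dist (chart_of \<Omega> b) (chart_of \<Omega> y) * dist (chart_of \<Omega> x) (chart_of \<Omega> a)))" for a b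
  have V: "near r (chart w x) (chart w y) \<longleftrightarrow> V a b \<le> r" if "chord_ends \<Omega> x y a b" for a b r
    unfolding V_def by (rule chord_value[OF x y False that])
  obtain a b where ab: "chord_ends \<Omega> x y a b" using chord_ends_exist[OF x y False] by blast
  have "hilbert_dist \<Omega> x y = (THE r. \<exists>a b. chord_ends \<Omega> x y a b \<and> r = V a b)"
    using False by (simp add: hilbert_dist_def V_def)
  also have "\<dots> = V a b"
  proof (rule the_equality)
    fix r assume "\<exists>a b. chord_ends \<Omega> x y a b \<and> r = V a b"
    then obtain a' b' where "chord_ends \<Omega> x y a' b'" "r = V a' b'" by blast
    then show "r = V a b" using V[OF ab] V by (metis order_antisym order_refl)
  qed (use ab in blast)
  finally show ?thesis using V[OF ab] by simp
qed

end

section \<open>Lifting projective automorphisms to the cone\<close>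

lemma pt_induces:
  assumes "induces A g" "v \<noteq> 0"
  shows "A *v v \<noteq> 0" "pt (A *v v) = g (pt v)"
proof -
  have inv: "invertible A" and l: "line_of (g (pt v)) = (*v) A ` line_of (pt v)"
    using assms(1) by (auto simp: induces_def)
  obtain A' where "A' ** A = mat 1" using inv by (auto simp: invertible_def)
  then have "A' *v (A *v v) = v" by (simp add: matrix_vector_mul_assoc)
  then show nz: "A *v v \<noteq> 0" using assms(2) by auto
  have "v \<in> line_of (pt v)" using in_line_of_pt[OF assms(2), of v] by (metis scaleR_one)
  then have "A *v v \<in> line_of (g (pt v))" using l by blast
  then show "pt (A *v v) = g (pt v)" using pt_unique nz by metis
qed

context convex_domain
begin

text \<open>An inducing matrix sends \<open>C\<close> either to itself or to its negative; the sign
  \<open>s\<close> corrects this. That the inverse preserves \<open>C\<close> as well comes from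
  \<open>g\<close> mapping \<Omega> onto itself.\<close>

lemma automorphism_lift:
  assumes A: "induces A g" and g: "g ` \<Omega> = \<Omega>"
  obtains h h' s where "linear h" "linear h'" "\<And>x. h (h' x) = x" "\<And>x. h' (h x) = x"
    "\<And>x. x \<in> C \<Longrightarrow> h x \<in> C" "\<And>x. x \<in> C \<Longrightarrow> h' x \<in> C" "\<And>v. h v = s *\<^sub>R (A *v v)"
    "\<And>v. v \<noteq> 0 \<Longrightarrow> pt (h v) = g (pt v)"
proof -
  obtain A' where A': "A ** A' = mat 1" "A' ** A = mat 1" using A by (auto simp: induces_def invertible_def)
  have Aneq: "w \<bullet> (A *v v) \<noteq> 0" if v: "v \<in> C" for v
  proof -
    have v0: "v \<noteq> 0" using v zero_notin_C by auto
    have "g (pt v) \<in> \<Omega>" using g pt_C[OF v] by blast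
    then have "pt (A *v v) \<in> chart_domain w" using pt_induces[OF A v0] \<Omega>_chart_domain by simp
    then show ?thesis using pt_in_chart_domain pt_induces[OF A v0] by blast
  qed
  obtain u where u: "u \<in> C" using C_nonempty by blast
  define s where "s = sgn (w \<bullet> (A *v u))"
  have s: "s * s = 1" "s \<noteq> 0" using Aneq[OF u] by (auto simp: s_def sgn_if)
  have spos: "s * (w \<bullet> (A *v v)) > 0" if v: "v \<in> C" for v
  proof (rule ccontr)
    assume "\<not> s * (w \<bullet> (A *v v)) > 0"
    then have n: "s * (w \<bullet> (A *v v)) < 0" using Aneq[OF v] s by (metis linorder_neqE_linordered_idom mult_eq_0_iff)
    have p: "s * (w \<bullet> (A *v u)) > 0" using Aneq[OF u] by (simp add: s_def sgn_if)
    \<comment> \<open>With opposite signs at \<open>u\<close> and \<open>v\<close>, this positive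
      combination lies in \<open>C\<close> while \<open>w\<close> vanishes on its image, contrary to
      \<open>Aneq\<close>.\<close>
    define z where "z = (- (s * (w \<bullet> (A *v v)))) *\<^sub>R u + (s * (w \<bullet> (A *v u))) *\<^sub>R v"
    have "z \<in> C" unfolding z_def using n p u v by (intro C_add C_scale) auto
    moreover have "w \<bullet> (A *v z) = 0"
      by (simp add: z_def matrix_vector_right_distrib matrix_vector_mult_scaleR inner_add_right del: scaleR_minus_left)
    ultimately show False using Aneq by blast
  qed
  define h where "h v = s *\<^sub>R (A *v v)" for v
  define h' where "h' v = s *\<^sub>R (A' *v v)" for v
  have lin: "linear h" "linear h'"
    by (simp_all add: linear_iff h_def h'_def matrix_vector_right_distrib matrix_vector_mult_scaleR scaleR_add_right)
  have inv: "h (h' x) = x" "h' (h x) = x" for x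
    using A' s by (simp_all add: h_def h'_def matrix_vector_mult_scaleR matrix_vector_mul_assoc)
  have pth: "pt (h v) = g (pt v)" if "v \<noteq> 0" for v
    using pt_induces[OF A that] s(2) by (simp add: h_def pt_scale)
  have hC: "h v \<in> C" if v: "v \<in> C" for v
  proof -
    have "v \<noteq> 0" using v zero_notin_C by auto
    then have "pt (h v) \<in> \<Omega>" using pth g pt_C[OF v] by auto
    then show ?thesis using spos[OF v] by (simp add: cone_def h_def)
  qed
  have h'C: "h' v \<in> C" if v: "v \<in> C" for v
  proof -
    have v0: "v \<noteq> 0" using v zero_notin_C by auto
    obtain q where q: "q \<in> \<Omega>" "pt v = g q" using g pt_C[OF v] by blast
    define x where "x = chart w q"
    have x: "x \<in> C" "pt x = q" using q chart_in_C pt_chart \<Omega>_chart_domain by (auto simp: x_def)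
    have x0: "x \<noteq> 0" using x(1) zero_notin_C by metis
    have "pt (h x) = pt v" using pth[OF x0] x(2) q(2) by simp
    moreover have "h x \<noteq> 0" using hC[OF x(1)] zero_notin_C by auto
    ultimately obtain c where c: "c \<noteq> 0" "h x = c *\<^sub>R v" using pt_eqD v0 by blast
    have "w \<bullet> h x > 0" "w \<bullet> v > 0" using hC[OF x(1)] v by (auto simp: cone_def)
    then have cpos: "c > 0" using c by (simp add: zero_less_mult_iff)
    have "x = h' (c *\<^sub>R v)" using inv c by metis
    then have "h' v = inverse c *\<^sub>R x" using c lin(2) by (simp add: linear_scale)
    then show ?thesis using C_scale[of "inverse c" x] cpos x by simp
  qed
  show ?thesis by (rule that[OF lin inv hC h'C h_def pth])
qed

end

context proper_cone
begin

text \<open>If \<open>s < 0\<close>, adding \<open>- s\<close> times \<open>a + b\<close> cancels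
  \<open>a\<close> and leaves a multiple of \<open>b\<close> in \<open>C\<close>. A positive
  multiple contradicts \<open>b \<notin> C\<close>, any other one
  \<open>0 \<notin> C\<close>.\<close>

lemma cone_of_axis:
  assumes a: "a \<in> K" "a \<notin> C" and b: "b \<in> K" "b \<notin> C" and ab: "a + b \<in> C" and st: "s *\<^sub>R a + t *\<^sub>R b \<in> K"
  shows "s \<ge> 0" "t \<ge> 0"
proof -
  have *: "s \<ge> 0" if a: "a \<in> K" "a \<notin> C" and b: "b \<in> K" "b \<notin> C" and ab: "a + b \<in> C" and st: "s *\<^sub>R a + t *\<^sub>R b \<in> K"
    for a b s t
  proof (rule ccontr)
    assume n: "\<not> s \<ge> 0"
    have "(s *\<^sub>R a + t *\<^sub>R b) + (- s) *\<^sub>R (a + b) \<in> C" using n by (intro K_C_add[OF st] C_scale[OF _ ab]) auto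
    then have C: "(t - s) *\<^sub>R b \<in> C" by (simp add: algebra_simps)
    show False
    proof (cases "t - s > 0")
      case True
      then show False using C_scale[OF _ C, of "inverse (t - s)"] b by simp
    next
      case False
      then have "(s - t) *\<^sub>R b \<in> K" using b by (intro K_scale) auto
      then have "(t - s) *\<^sub>R b + (s - t) *\<^sub>R b \<in> C" using C by (intro C_K_add)
      then show False using zero_notin_C by (simp add: algebra_simps)
    qed
  qed
  show "s \<ge> 0" using *[OF assms] .
  show "t \<ge> 0" using *[OF b a, of t s] ab st by (simp add: add.commute)
qed

end

section \<open>Transfer from the cone to the domain\<close>

context charted_convex_domain
begin

lemma near_hilbert_dist: "x \<in> \<Omega> \<Longrightarrow> y \<in> \<Omega> \<Longrightarrow> near (hilbert_dist \<Omega> x y) (chart w x) (chart w y)"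
  using hilbert_dist_le_iff by blast

lemma hilbert_dist_nonneg: "x \<in> \<Omega> \<Longrightarrow> y \<in> \<Omega> \<Longrightarrow> hilbert_dist \<Omega> x y \<ge> 0"
  using near_nonneg chart_in_C near_hilbert_dist by blast

lemma hilbert_dist_sym: "x \<in> \<Omega> \<Longrightarrow> y \<in> \<Omega> \<Longrightarrow> hilbert_dist \<Omega> x y = hilbert_dist \<Omega> y x"
  using near_sym chart_in_C near_hilbert_dist hilbert_dist_le_iff by (meson order_antisym)

lemma hilbert_dist_triangle:
  "x \<in> \<Omega> \<Longrightarrow> y \<in> \<Omega> \<Longrightarrow> z \<in> \<Omega> \<Longrightarrow> hilbert_dist \<Omega> x z \<le> hilbert_dist \<Omega> x y + hilbert_dist \<Omega> y z"
  using near_trans chart_in_C near_hilbert_dist hilbert_dist_le_iff by meson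

lemma translation_length_nonpos:
  assumes "x \<in> \<Omega>" "g x = x" "g ` \<Omega> \<subseteq> \<Omega>"
  shows "translation_length \<Omega> g \<le> 0"
proof -
  have "bdd_below ((\<lambda>x. hilbert_dist \<Omega> x (g x)) ` \<Omega>)"
    using assms(3) hilbert_dist_nonneg by (intro bdd_belowI[of _ 0]) auto
  then have "translation_length \<Omega> g \<le> hilbert_dist \<Omega> x (g x)"
    unfolding translation_length_def using assms(1) by (rule cINF_lower)
  then show ?thesis using assms(2) by (simp add: hilbert_dist_def)
qed

lemma morse_of_cone_axis:
  assumes ax: "proper_cone_axis C w h h' a b lam mu"
    and l: "l = {pt (s *\<^sub>R a + t *\<^sub>R b) | s t. s > 0 \<and> t > 0}"
  shows "\<exists>K. morse_gauge K \<and> morse \<Omega> K l"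
proof -
  interpret ax: proper_cone_axis C w h h' a b lam mu by (rule ax)
  obtain \<pi> B where \<pi>:
    "\<forall>x\<in>C. \<forall>y\<in>C. \<forall>r. near r x y \<longrightarrow> \<bar>\<pi> x - \<pi> y\<bar> \<le> r"
    "\<forall>s>0. \<forall>t>0. \<forall>s'>0. \<forall>t'>0. near \<bar>\<pi> (s *\<^sub>R a + t *\<^sub>R b) - \<pi> (s' *\<^sub>R a + t' *\<^sub>R b)\<bar>
          (s *\<^sub>R a + t *\<^sub>R b) (s' *\<^sub>R a + t' *\<^sub>R b)"
    "\<forall>x\<in>C. \<forall>y\<in>C. \<bar>\<pi> x - \<pi> y\<bar> > B \<longrightarrow> ax.segment_near_axis x y"
    using ax.axis_contracting by (elim exE conjE) (rule that)
  have lip: "\<bar>\<pi> x - \<pi> y\<bar> \<le> r" if "x \<in> C" "y \<in> C" "near r x y" for x y r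
    using \<pi>(1) that by blast
  have geod: "near \<bar>\<pi> (s *\<^sub>R a + t *\<^sub>R b) - \<pi> (s' *\<^sub>R a + t' *\<^sub>R b)\<bar> (s *\<^sub>R a + t *\<^sub>R b) (s' *\<^sub>R a + t' *\<^sub>R b)"
    if "s > 0" "t > 0" "s' > 0" "t' > 0" for s t s' t'
    using \<pi>(2) that by blast
  have contr: "ax.segment_near_axis x y" if "x \<in> C" "y \<in> C" "\<bar>\<pi> x - \<pi> y\<bar> > B" for x y
    using \<pi>(3) that by blast
  have C_axis: "s *\<^sub>R a + t *\<^sub>R b \<in> C" if "s > 0" "t > 0" for s t using ax.C_axis that .
  have l\<Omega>: "l \<subseteq> \<Omega>" using C_axis pt_C by (auto simp: l)
  have chart_l: "\<exists>s>0. \<exists>t>0. chart w p = s *\<^sub>R a + t *\<^sub>R b" if "p \<in> l" for p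
  proof -
    obtain s t where st: "s > 0" "t > 0" "p = pt (s *\<^sub>R a + t *\<^sub>R b)" using \<open>p \<in> l\<close> by (auto simp: l)
    define c where "c = inverse (w \<bullet> (s *\<^sub>R a + t *\<^sub>R b))"
    have "c > 0" using C_axis[OF st(1,2)] by (simp add: c_def cone_def)
    moreover have "chart w p = (c * s) *\<^sub>R a + (c * t) *\<^sub>R b"
      using C_axis[OF st(1,2)] unfolding st(3)
      by (subst chart_pt) (auto simp: c_def cone_def scaleR_add_right)
    ultimately show ?thesis using st by (meson mult_pos_pos)
  qed
  \<comment> \<open>If \<pi> changed by more than \<open>B\<close>, some point of the segment would
    be within 1 of the axis. It is no farther from \<open>x\<close> than \<open>y\<close> is, so the
    axis would come within \<open>hilbert_dist \<Omega> x y + 1\<close> of \<open>x\<close>; the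
    constant 2 excludes this.\<close>
  have contr': "\<bar>\<pi> (chart w x) - \<pi> (chart w y)\<bar> \<le> B"
    if x: "x \<in> \<Omega>" and y: "y \<in> \<Omega>" and far: "\<forall>p\<in>l. hilbert_dist \<Omega> x y + 2 \<le> hilbert_dist \<Omega> x p" for x y
  proof (rule ccontr)
    assume "\<not> ?thesis"
    then have "ax.segment_near_axis (chart w x) (chart w y)" using x y chart_in_C by (intro contr) auto
    then obtain s t c d where 1: "s > 0" "t > 0" "c > 0" "d > 0"
      "near 1 (s *\<^sub>R chart w x + t *\<^sub>R chart w y) (c *\<^sub>R a + d *\<^sub>R b)"
      unfolding ax.segment_near_axis_def by blast
    define v where "v = c *\<^sub>R a + d *\<^sub>R b"
    define r where "r = hilbert_dist \<Omega> x y"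
    have v: "v \<in> C" "w \<bullet> v > 0" using C_axis 1 by (auto simp: v_def cone_def)
    have "near r (chart w x) (s *\<^sub>R chart w x + t *\<^sub>R chart w y)"
      unfolding r_def using 1 x y hilbert_dist_nonneg near_hilbert_dist by (intro near_combination) auto
    then have "near (r + 1) (chart w x) v"
      using near_trans[OF chart_in_C[OF x] _ 1(5)] by (simp add: v_def)
    then have "near (r + 1) (1 *\<^sub>R chart w x) (inverse (w \<bullet> v) *\<^sub>R v)"
      using v by (intro near_scale) auto
    then have "near (r + 1) (chart w x) (chart w (pt v))" using v by (simp add: chart_pt)
    then have "hilbert_dist \<Omega> x (pt v) \<le> r + 1" using x pt_C[OF v(1)] hilbert_dist_le_iff by blast
    moreover have "pt v \<in> l" using 1 by (auto simp: l v_def)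
    ultimately show False using far by (force simp: r_def)
  qed
  \<comment> \<open>Naming the property allows a radius to be selected as a function of
    \<open>lam\<close> and \<open>eps\<close> alone.\<close>
  define P where "P lam eps R \<longleftrightarrow> R \<ge> 0 \<and> (\<forall>s t (F :: real \<Rightarrow> _). s \<le> t \<longrightarrow> F ` {s..t} \<subseteq> \<Omega> \<longrightarrow> F s \<in> l \<longrightarrow> F t \<in> l \<longrightarrow>
      (\<forall>u\<in>{s..t}. \<forall>v\<in>{s..t}. 1 / lam * \<bar>u - v\<bar> - eps \<le> hilbert_dist \<Omega> (F u) (F v)
          \<and> hilbert_dist \<Omega> (F u) (F v) \<le> lam * \<bar>u - v\<bar> + eps) \<longrightarrow>
      (\<forall>u\<in>{s..t}. \<exists>p\<in>l. hilbert_dist \<Omega> (F u) p \<le> R))" for lam eps R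
  have "\<exists>R. P lam eps R" if le: "lam \<ge> 1" "eps \<ge> 0" for lam eps
    unfolding P_def
  proof (rule quasi_geodesic_near_contracting[where \<pi> = "\<lambda>x. \<pi> (chart w x)" and N = 2 and B = B])
    fix p q assume "p \<in> l" "q \<in> l"
    then obtain s t s' t' where "s > 0" "t > 0" "s' > 0" "t' > 0" "chart w p = s *\<^sub>R a + t *\<^sub>R b" "chart w q = s' *\<^sub>R a + t' *\<^sub>R b"
      using chart_l by meson
    then show "hilbert_dist \<Omega> p q \<le> \<bar>\<pi> (chart w p) - \<pi> (chart w q)\<bar>"
      using hilbert_dist_le_iff \<open>p \<in> l\<close> \<open>q \<in> l\<close> l\<Omega> geod by (metis subsetD)
  next
    fix x y assume "x \<in> \<Omega>" "y \<in> \<Omega>"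
    then show "\<bar>\<pi> (chart w x) - \<pi> (chart w y)\<bar> \<le> hilbert_dist \<Omega> x y"
      by (intro lip chart_in_C near_hilbert_dist)
  next
    show "hilbert_dist \<Omega> x x = 0" for x by (simp add: hilbert_dist_def)
  qed ((fact hilbert_dist_sym hilbert_dist_triangle l\<Omega> contr' le)+)
  then obtain R where R: "\<And>lam eps. lam \<ge> 1 \<Longrightarrow> eps \<ge> 0 \<Longrightarrow> P lam eps (R lam eps)" by metis
  \<comment> \<open>The 1 is added because \<open>hilbert_nbhd\<close> is defined by a strict
    inequality.\<close>
  define G where "G z = R (fst z) (snd z) + 1" for z
  have "morse_gauge G" unfolding morse_gauge_def using R by (auto simp: G_def P_def intro!: add_nonneg_nonneg)
  moreover have "morse \<Omega> G l" unfolding morse_def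
  proof (intro allI impI ballI subsetI)
    fix lam eps p q \<alpha> x
    assume le: "1 \<le> lam" "0 \<le> eps" and pq: "p \<in> l" "q \<in> l" and "quasi_geodesic_between \<Omega> lam eps p q \<alpha>" and x: "x \<in> \<alpha>"
    then obtain s t F where F: "s \<le> t" "quasi_isometric_embedding \<Omega> lam eps {s..t} F" "F s = p" "F t = q" "\<alpha> = F ` {s..t}"
      unfolding quasi_geodesic_between_def by blast
    obtain u where u: "u \<in> {s..t}" "x = F u" using x F by auto
    obtain p' where p': "p' \<in> l" "hilbert_dist \<Omega> x p' \<le> R lam eps"
      using R[OF le] F pq u unfolding quasi_isometric_embedding_def P_def by blast
    have x\<Omega>: "x \<in> \<Omega>" using F(2) u by (auto simp: quasi_isometric_embedding_def)
    have "bdd_below (hilbert_dist \<Omega> x ` l)" using hilbert_dist_nonneg x\<Omega> l\<Omega> by (intro bdd_belowI[of _ 0]) auto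
    then have "(INF y\<in>l. hilbert_dist \<Omega> x y) \<le> hilbert_dist \<Omega> x p'" using p'(1) by (rule cINF_lower)
    then show "x \<in> hilbert_nbhd \<Omega> (G (lam, eps)) l"
      using p'(2) x\<Omega> by (simp add: hilbert_nbhd_def G_def)
  qed
  ultimately show ?thesis by blast
qed

text \<open>An axis is described both as a plane section of \<Omega> and as an open segment.
  Comparing the two puts the ends in the plane and outside \<Omega>: an end in \<Omega> would belong
  to the section, while \<open>segment_open\<close> omits it.\<close>

lemma axis_eq_cone:
  assumes V: "subspace V" "l = proj_of V \<inter> \<Omega>" and ab: "a \<in> closure \<Omega>" "b \<in> closure \<Omega>" "a \<noteq> b"
    and l: "l = segment_open \<Omega> a b"
  shows "l = {pt (s *\<^sub>R chart w a + t *\<^sub>R chart w b) | s t. s > 0 \<and> t > 0}"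
    and "chart w a \<in> V" "chart w b \<in> V" "chart w a \<notin> C" "chart w b \<notin> C" "chart w a + chart w b \<in> C"
proof -
  define A where "A = chart w a"
  define B where "B = chart w b"
  have AB: "A \<in> K" "B \<in> K" "w \<bullet> A = 1" "w \<bullet> B = 1" "pt A = a" "pt B = b"
    using ab chart_in_K chart_closure by (simp_all add: A_def B_def)
  have ne: "A \<noteq> B" using ab(3) AB by auto
  have in_l: "pt (s *\<^sub>R A + t *\<^sub>R B) \<in> l" if st: "s > 0" "t > 0" for s t
  proof -
    define v where "v = s *\<^sub>R A + t *\<^sub>R B"
    have wv: "w \<bullet> v = s + t" using AB by (simp add: v_def inner_add_right)
    have v: "v \<in> K" "v \<noteq> 0" unfolding v_def using AB st wv by (auto intro!: K_add K_scale simp: v_def)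
    define u where "u = t / (s + t)"
    have u: "0 < u" "u < 1" using st by (auto simp: u_def)
    have "chart w (pt v) = inverse (s + t) *\<^sub>R v" using wv st by (subst chart_pt) auto
    also have "\<dots> = (1 - u) *\<^sub>R A + u *\<^sub>R B"
    proof -
      have "1 - u = inverse (s + t) * s" "u = inverse (s + t) * t" using st by (simp_all add: u_def field_simps)
      then show ?thesis by (simp add: v_def scaleR_add_right)
    qed
    finally have ch: "chart w (pt v) = (1 - u) *\<^sub>R A + u *\<^sub>R B" .
    have "chart w (pt v) \<in> closed_segment A B" unfolding ch in_segment using u by (intro exI[of _ u]) auto
    then have "pt v \<in> segment \<Omega> a b" using pt_K[OF v] by (simp add: in_segment_iff A_def B_def)
    moreover have "chart w (pt v) \<noteq> A"
    proof
      assume "chart w (pt v) = A"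
      moreover have "(1 - u) *\<^sub>R A + u *\<^sub>R B - A = u *\<^sub>R (B - A)" by (simp add: scaleR_diff_left scaleR_diff_right)
      ultimately have "u *\<^sub>R (B - A) = 0" unfolding ch by simp
      then show False using u ne by simp
    qed
    moreover have "chart w (pt v) \<noteq> B"
    proof
      assume "chart w (pt v) = B"
      moreover have "(1 - u) *\<^sub>R A + u *\<^sub>R B - B = (1 - u) *\<^sub>R (A - B)" by (simp add: scaleR_diff_left scaleR_diff_right)
      ultimately have "(1 - u) *\<^sub>R (A - B) = 0" unfolding ch by simp
      then show False using u ne by simp
    qed
    ultimately show ?thesis unfolding l segment_open_def v_def by (auto simp: A_def B_def)
  qed
  show "l = {pt (s *\<^sub>R chart w a + t *\<^sub>R chart w b) | s t. s > 0 \<and> t > 0}"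
  proof (intro equalityI subsetI)
    fix p assume "p \<in> l"
    then have p: "p \<in> closure \<Omega>" "chart w p \<in> closed_segment A B" "p \<noteq> a" "p \<noteq> b"
      by (auto simp: l segment_open_def in_segment_iff A_def B_def)
    then obtain u where u: "0 \<le> u" "u \<le> 1" "chart w p = (1 - u) *\<^sub>R A + u *\<^sub>R B" by (auto simp: in_segment)
    have pp: "p = pt (chart w p)" using chart_closure(2)[OF p(1)] by simp
    have "u \<noteq> 0" "u \<noteq> 1" using pp p(3,4) u(3) AB by auto
    then have "1 - u > 0" "u > 0" using u by auto
    then show "p \<in> {pt (s *\<^sub>R chart w a + t *\<^sub>R chart w b) | s t. s > 0 \<and> t > 0}"
      using pp unfolding u(3) A_def[symmetric] B_def[symmetric] by blast
  qed (use in_l in \<open>auto simp: A_def B_def\<close>)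
  have in_V: "s *\<^sub>R A + t *\<^sub>R B \<in> V" "s *\<^sub>R A + t *\<^sub>R B \<in> C" if st: "s > 0" "t > 0" for s t
  proof -
    have w: "w \<bullet> (s *\<^sub>R A + t *\<^sub>R B) > 0" using AB st by (simp add: inner_add_right)
    then have nz: "s *\<^sub>R A + t *\<^sub>R B \<noteq> 0" by auto
    have "pt (s *\<^sub>R A + t *\<^sub>R B) \<in> proj_of V" "pt (s *\<^sub>R A + t *\<^sub>R B) \<in> \<Omega>" using in_l[OF st] V(2) by auto
    then show "s *\<^sub>R A + t *\<^sub>R B \<in> V" "s *\<^sub>R A + t *\<^sub>R B \<in> C"
      using w by (auto simp: proj_of_def line_of_pt[OF nz] cone_def intro: span_base)
  qed
  \<comment> \<open>Differences of these three vectors of \<open>V\<close> isolate \<open>A\<close>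
    and \<open>B\<close>.\<close>
  have i: "1 *\<^sub>R A + 1 *\<^sub>R B \<in> V" "2 *\<^sub>R A + 1 *\<^sub>R B \<in> V" "1 *\<^sub>R A + 2 *\<^sub>R B \<in> V" by (rule in_V; simp)+
  have ABV: "A \<in> V" "B \<in> V"
    using subspace_diff[OF V(1) i(2) i(1)] subspace_diff[OF V(1) i(3) i(1)] by (simp_all add: scaleR_2)
  then show "chart w a \<in> V" "chart w b \<in> V" by (simp_all add: A_def B_def)
  show "chart w a + chart w b \<in> C" using in_V(2)[of 1 1] by (simp add: A_def B_def)
  have nC: "X \<notin> C" if X: "X \<in> V" "pt X \<in> {a, b}" for X
  proof
    assume C: "X \<in> C"
    then have "X \<noteq> 0" using zero_notin_C by auto
    then have "pt X \<in> proj_of V" using X(1) V(1) by (simp add: proj_of_def line_of_pt span_minimal)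
    then have "pt X \<in> l" using V(2) pt_C[OF C] by blast
    then show False using X(2) by (auto simp: l segment_open_def)
  qed
  show "chart w a \<notin> C" "chart w b \<notin> C" using nC ABV AB by (auto simp: A_def B_def)
qed

text \<open>\<open>add_in_C\<close> spreads the two conditions on sums to all points of the two
  sides; the apex is the point represented by \<open>z\<close>.\<close>

lemma half_triangle_of_cone:
  assumes ab: "a \<in> closure \<Omega>" "b \<in> closure \<Omega>"
    and z: "z \<in> K" "chart w a + z \<notin> C" "chart w b + z \<notin> C" "z \<noteq> 0"
  shows "in_half_triangle \<Omega> a b"
proof -
  have wz: "w \<bullet> z > 0" using K_inner_pos z by auto
  define c where "c = inverse (w \<bullet> z)"
  have c: "c > 0" using wz by (simp add: c_def)
  have ch: "chart w (pt z) = c *\<^sub>R z" using wz by (simp add: chart_pt c_def)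
  have clz: "pt z \<in> closure \<Omega>" using pt_K z by auto
  have seg: "u *\<^sub>R x + v *\<^sub>R (c *\<^sub>R z) \<notin> C" if "x \<in> K" "x + z \<notin> C" "u \<ge> 0" "v \<ge> 0" for u v x
    using add_in_C[OF that(1) z(1) that(3), of "v * c"] that c by auto
  have K: "chart w a \<in> K" "chart w b \<in> K" using ab chart_in_K by auto
  have "segment \<Omega> a (pt z) \<subseteq> frontier \<Omega>"
    using seg[OF K(1) z(2)] by (auto simp: in_segment_iff in_frontier_iff ch in_segment)
  moreover have "segment \<Omega> (pt z) b \<subseteq> frontier \<Omega>"
    using seg[OF K(2) z(3)] by (auto simp: in_segment_iff in_frontier_iff ch in_segment add.commute)
  moreover have "pt z \<in> segment \<Omega> (pt z) b" using clz by (simp add: in_segment_iff)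
  ultimately show ?thesis unfolding in_half_triangle_def by blast
qed

text \<open>The lift maps the quadrant spanned by the two ends in \<open>V\<close> to itself and
  sends each of its edges to an edge. Injectivity keeps the images of the edges distinct. An
  exchange of the edges, or equal eigenvalues, would give a fixed point in \<Omega>, contrary to
  positive translation length. The end with the larger eigenvalue then plays the role of
  \<open>a\<close>.\<close>

lemma rank_one_axis_morse:
  assumes r1: "rank_one_isometry \<Omega> \<gamma>" and axis: "is_axis \<Omega> \<gamma> l"
  shows "\<exists>K. morse_gauge K \<and> morse \<Omega> K l"
proof -
  obtain V A a b where V: "subspace V" "induces A \<gamma>" "(\<lambda>v. A *v v) ` V \<subseteq> V" "dim V = 2" "l = proj_of V \<inter> \<Omega>"
    and ab: "a \<in> closure \<Omega>" "b \<in> closure \<Omega>" "a \<noteq> b" "l = segment_open \<Omega> a b"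
    using axis unfolding is_axis_def invariant_subspace_def by blast
  have \<gamma>\<Omega>: "\<gamma> ` \<Omega> = \<Omega>" and tl: "translation_length \<Omega> \<gamma> > 0"
    using r1 by (auto simp: rank_one_isometry_def Aut_def)
  define x where "x = chart w a"
  define y where "y = chart w b"
  note ax = axis_eq_cone[OF V(1,5) ab, folded x_def y_def]
  have xy: "x \<in> K" "y \<in> K" "w \<bullet> x = 1" "w \<bullet> y = 1" using ab chart_in_K chart_closure by (simp_all add: x_def y_def)
  have ne: "x \<noteq> y" using ab chart_eq by (simp add: x_def y_def)
  have fr: "a \<in> frontier \<Omega>" "b \<in> frontier \<Omega>" using ab ax by (auto simp: in_frontier_iff x_def y_def)
  have not_ht: "\<not> in_half_triangle \<Omega> a b" using r1 fr axis ab(4) by (auto simp: rank_one_isometry_def)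
  have nht: "z = 0" if "z \<in> K" "x + z \<notin> C" "y + z \<notin> C" for z
    using half_triangle_of_cone[OF ab(1,2)] that not_ht by (auto simp: x_def y_def)
  show ?thesis
  proof (rule automorphism_lift[OF V(2) \<gamma>\<Omega>])
    fix h h' s
    assume lin: "linear h" "linear h'" and inv: "\<And>x. h (h' x) = x" "\<And>x. h' (h x) = x"
      and hC: "\<And>x. x \<in> C \<Longrightarrow> h x \<in> C" "\<And>x. x \<in> C \<Longrightarrow> h' x \<in> C" and hs: "\<And>v. h v = s *\<^sub>R (A *v v)"
      and pth: "\<And>v. v \<noteq> 0 \<Longrightarrow> pt (h v) = \<gamma> (pt v)"
    have hV: "h v \<in> V" if "v \<in> V" for v using V(1,3) that by (auto simp: hs intro: subspace_scale)
    have "closed (h -` K)" using lin(1) by (intro closed_vimage linear_continuous_on) (auto simp: linear_conv_bounded_linear)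
    then have "K \<subseteq> h -` K" by (rule closure_minimal[rotated]) (auto intro: hC C_K)
    then have hK: "\<And>v. v \<in> K \<Longrightarrow> h v \<in> K" by auto
    have hC_iff: "h v \<in> C \<longleftrightarrow> v \<in> C" for v using hC inv by metis
    have span_V: "V = span {x, y}"
    proof -
      have "x \<notin> span {y}"
      proof
        assume "x \<in> span {y}"
        then obtain c where c: "x = c *\<^sub>R y" by (auto simp: span_singleton)
        then have "c = 1" using xy by (metis inner_scaleR_right mult.right_neutral)
        then show False using c ne by simp
      qed
      moreover have "y \<noteq> 0" using xy by auto
      ultimately have "independent {x, y}" by (simp add: independent_insert)
      then have "dim (span {x, y}) = 2" using ne by (simp add: dim_eq_card_independent)
      moreover have "span {x, y} \<subseteq> V" using ax V(1) by (simp add: span_minimal)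
      ultimately show ?thesis using V(1,4) by (metis subspace_dim_equal subspace_span order_refl)
    qed
    have V_form: "\<exists>p q. v = p *\<^sub>R x + q *\<^sub>R y" if v: "v \<in> V" for v
    proof -
      have "v \<in> span (insert x {y})" using v span_V by simp
      then obtain p where "v - p *\<^sub>R x \<in> span {y}" using span_breakdown_eq by blast
      then obtain q where "v - p *\<^sub>R x = q *\<^sub>R y" by (auto simp: span_singleton)
      then show ?thesis by (metis add.commute diff_add_cancel)
    qed
    have in_l: "pt (p *\<^sub>R x + q *\<^sub>R y) \<in> l" if "p > 0" "q > 0" for p q
      unfolding ax(1) mem_Collect_eq by (intro exI[of _ p] exI[of _ q] conjI refl that)
    \<comment> \<open>The image of an end has nonnegative coefficients by
      \<open>cone_of_axis\<close>; were both positive, it would represent a point of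
      \<Omega>.\<close>
    have bd: "(\<exists>p>0. h v = p *\<^sub>R x) \<or> (\<exists>q>0. h v = q *\<^sub>R y)" if v: "v \<in> {x, y}" for v
    proof -
      have v1: "v \<in> V" "v \<in> K" "v \<notin> C" "v \<noteq> 0" using v ax xy by auto
      obtain p q where pq: "h v = p *\<^sub>R x + q *\<^sub>R y" using V_form[OF hV[OF v1(1)]] by blast
      have pos: "p \<ge> 0" "q \<ge> 0"
        using cone_of_axis[OF xy(1) ax(4) xy(2) ax(5,6)] hK[OF v1(2)] pq by auto
      have hv: "h v \<notin> C" using hC_iff v1 by simp
      have "h v \<noteq> 0" using inv(2)[of v] v1(4) linear_0[OF lin(2)] by metis
      moreover have "p = 0 \<or> q = 0"
      proof (rule ccontr)
        assume "\<not> (p = 0 \<or> q = 0)"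
        then have "pt (p *\<^sub>R x + q *\<^sub>R y) \<in> l" using pos by (intro in_l) auto
        then have "pt (p *\<^sub>R x + q *\<^sub>R y) \<in> \<Omega>" using V(5) by blast
        moreover have "w \<bullet> (p *\<^sub>R x + q *\<^sub>R y) > 0"
          using \<open>\<not> (p = 0 \<or> q = 0)\<close> pos xy by (simp add: inner_add_right)
        ultimately show False using hv pq by (simp add: cone_def)
      qed
      ultimately consider "p = 0" "q > 0" | "q = 0" "p > 0" using pos pq by fastforce
      then show ?thesis using pq by cases auto
    qed
    have no_fix: False if pq: "p > 0" "q > 0" and e: "h (p *\<^sub>R x + q *\<^sub>R y) = e *\<^sub>R (p *\<^sub>R x + q *\<^sub>R y)" for p q e
    proof -
      define v where "v = p *\<^sub>R x + q *\<^sub>R y"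
      have "pt v \<in> l" using pq unfolding v_def by (intro in_l)
      then have v\<Omega>: "pt v \<in> \<Omega>" using V(5) by blast
      have wv: "w \<bullet> v > 0" using pq xy by (simp add: v_def inner_add_right)
      then have "v \<noteq> 0" by auto
      then have "h v \<noteq> 0" using inv(2)[of v] linear_0[OF lin(2)] by metis
      then have "e \<noteq> 0" using e by (auto simp: v_def)
      then have "\<gamma> (pt v) = pt v" using pth[OF \<open>v \<noteq> 0\<close>] e pt_scale[OF _ \<open>v \<noteq> 0\<close>] by (simp add: v_def)
      then show False using translation_length_nonpos[OF v\<Omega>] \<gamma>\<Omega> tl by force
    qed
    have inj: "u = v" if "h u = h v" for u v using inv(2) that by metis
    consider p q where "p > 0" "q > 0" "h x = p *\<^sub>R x" "h y = q *\<^sub>R y"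
      | p q where "p > 0" "q > 0" "h x = q *\<^sub>R y" "h y = p *\<^sub>R x"
      | p q where "p > 0" "q > 0" "h x = p *\<^sub>R x" "h y = q *\<^sub>R x"
      | p q where "p > 0" "q > 0" "h x = p *\<^sub>R y" "h y = q *\<^sub>R y"
      using bd[of x] bd[of y] by blast
    then show ?thesis
    proof cases
      case (1 p q)
      have "p \<noteq> q"
      proof
        assume "p = q"
        then have "h (1 *\<^sub>R x + 1 *\<^sub>R y) = p *\<^sub>R (1 *\<^sub>R x + 1 *\<^sub>R y)"
          using 1 lin(1) by (simp add: linear_add scaleR_add_right)
        then show False using no_fix[of 1 1 p] by simp
      qed
      then consider "p > q" | "q > p" by linarith
      then show ?thesis
      proof cases
        case 1
        then have "proper_cone_axis C w h h' x y p q"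
          using \<open>q > 0\<close> \<open>h x = p *\<^sub>R x\<close> \<open>h y = q *\<^sub>R y\<close>
          by unfold_locales (use lin inv hC xy ax nht in \<open>simp_all add: linear_add linear_scale\<close>)
        then show ?thesis by (rule morse_of_cone_axis[OF _ ax(1)])
      next
        case 2
        then have "proper_cone_axis C w h h' y x q p"
          using \<open>p > 0\<close> \<open>h x = p *\<^sub>R x\<close> \<open>h y = q *\<^sub>R y\<close>
          by unfold_locales (use lin inv hC xy ax nht in \<open>simp_all add: linear_add linear_scale add.commute\<close>)
        moreover have "l = {pt (s *\<^sub>R y + t *\<^sub>R x) | s t. s > 0 \<and> t > 0}"
          unfolding ax(1) by (rule Collect_cong, subst ex_comm) (simp add: add.commute conj_commute)
        ultimately show ?thesis by (rule morse_of_cone_axis)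
      qed
    next
      case (2 p q)
      \<comment> \<open>The square roots are the coefficients whose ratio an exchange of the two
        rays preserves.\<close>
      have "h (sqrt p *\<^sub>R x + sqrt q *\<^sub>R y) = (sqrt p * sqrt q) *\<^sub>R (sqrt p *\<^sub>R x + sqrt q *\<^sub>R y)"
      proof -
        have "h (sqrt p *\<^sub>R x + sqrt q *\<^sub>R y) = (sqrt p * q) *\<^sub>R y + (sqrt q * p) *\<^sub>R x"
          using 2 lin(1) by (simp add: linear_add linear_scale)
        moreover have "sqrt p * q = sqrt p * sqrt q * sqrt q" "sqrt q * p = sqrt p * sqrt q * sqrt p"
          using 2 by (simp_all add: mult.assoc mult.left_commute)
        ultimately show ?thesis by (simp add: scaleR_add_right add.commute)
      qed
      then show ?thesis using no_fix[of "sqrt p" "sqrt q"] 2 by force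
    next
      case (3 p q)
      then have "h (q *\<^sub>R x) = h (p *\<^sub>R y)" using lin(1) by (simp add: linear_scale)
      then have e: "q *\<^sub>R x = p *\<^sub>R y" by (rule inj)
      then have "q = p" using xy by (metis inner_scaleR_right mult.right_neutral)
      then show ?thesis using e ne 3 by simp
    next
      case (4 p q)
      then have "h (q *\<^sub>R x) = h (p *\<^sub>R y)" using lin(1) by (simp add: linear_scale)
      then have e: "q *\<^sub>R x = p *\<^sub>R y" by (rule inj)
      then have "q = p" using xy by (metis inner_scaleR_right mult.right_neutral)
      then show ?thesis using e ne 4 by simp
    qed
  qed
qed

end

theorem proposition1p12:
  fixes \<Omega> :: "('n::finite) proj set" and \<gamma> :: "'n proj \<Rightarrow> 'n proj" and l :: "'n proj set"
  assumes "properly_convex_domain \<Omega>"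
    and "rank_one_isometry \<Omega> \<gamma>"
    and "is_axis \<Omega> \<gamma> l"
  shows "\<exists>K. morse_gauge K \<and> morse \<Omega> K l"
proof -
  \<comment> \<open>This is literally the choice made inside \<open>chart_of\<close>, so the locale
    assumption holds by unfolding.\<close>
  define w where "w = (SOME w. convex_in_chart w \<Omega>)"
  have "\<exists>w. convex_in_chart w \<Omega>" using assms(1) by (simp add: properly_convex_domain_def)
  then have "convex_in_chart w \<Omega>" unfolding w_def by (rule someI_ex)
  then interpret charted_convex_domain \<Omega> w
    using assms(1) by unfold_locales (simp_all add: properly_convex_domain_def chart_of_def w_def)
  show ?thesis using assms(2,3) by (rule rank_one_axis_morse)
qed

end
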